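(* Let $(X,\triangleleft)$ be a finite abelian quandle with $r$ orbits, with structure group $G(X,\triangleleft)$ and parameter group $G'(X,\triangleleft)$. Then $G(X,\triangleleft)$ is a central extension of $\mathbb{Z}^r$ by $G'(X,\triangleleft)$, i.e. there is a short exact sequence of groups $1\to G'(X,\triangleleft)\to G(X,\triangleleft)\to\mathbb{Z}^r\to 1$ with the image of $G'(X,\triangleleft)$ central in $G(X,\triangleleft)$. Moreover, $G'(X,\triangleleft)$ is a finite abelian group, and is isomorphic to the commutator subgroup of $G(X,\triangleleft)$.
   Context: A quandle is a non-empty set $X$ with a binary operation $\triangleleft$ such that for all $a,b,c$: $(a\triangleleft b)\triangleleft c=(a\triangleleft c)\triangleleft(b\triangleleft c)$; the right translation $-\triangleleft b$ is a bijection of $X$; $a\triangleleft a=a$. Its orbits are the orbits of $X$ under the group generated by all right translations. It is abelian if $(a\triangleleft b)\triangleleft c=(a\triangleleft c)\triangleleft b$ for all $a,b,c$. Its structure group is $G(X,\triangleleft)=\langle g_a,\ a\in X\mid g_ag_b=g_bg_{a\triangleleft b},\ a,b\in X\rangle$. Parameters. Let $r\ge 1$. A parameter collection is a family of integers $M=(m_{i,j})_{1\le j\le i<r}$ with $m_{i,i}\ge 1$ and $0\le m_{j,i}<m_{i,i}$ for $i<j$ (empty if $r=1$). It defines the finite abelian group $G(M)$ generated by pairwise commuting $x_1,\ldots,x_{r-1}$ subject to $x_1^{m_{i,1}}x_2^{m_{i,2}}\cdots x_i^{m_{i,i}}=1$ for $1\le i\le r-1$. Put $x_0:=1$. Given $r$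 parameter collections, let $Q(M^{(1)},\ldots,M^{(r)})=G(M^{(1)})\sqcup\cdots\sqcup G(M^{(r)})$, with $x_k^{(i)}$ denoting the element $x_k$ of $G(M^{(i)})$, and $a\triangleleft b=a\,x_k^{(i)}$ for $a\in G(M^{(i)})$, $b\in G(M^{(i+k)})$, $0\le k<r$ ($i+k$ modulo $r$). This is an abelian quandle with orbits $G(M^{(i)})$. Every finite abelian quandle with ordered orbits $O_1,\ldots,O_r$ is isomorphic, by an isomorphism matching $O_i$ with $G(M^{(i)})$ for all $i$, to $Q(M^{(1)},\ldots,M^{(r)})$ for unique $M^{(1)},\ldots,M^{(r)}$, called its parameters. Orbits are assumed ordered. The parameter group of $(X,\triangleleft)$ is the quotient $G'(X,\triangleleft)=\prod_{i=1}^rG(M^{(i)})\big/\langle x^{(i)}_{j-i}x^{(j)}_{i-j},\ 1\le i<j\le r\rangle$, lower indices being taken modulo $r$ in $\{0,\dots,r-1\}$. *)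

theory Defs
  imports
    "HOL-Algebra.Bij" "HOL-Algebra.Group_Action" "HOL-Algebra.Generated_Groups"
    "HOL-Algebra.Product_Groups" "HOL-Algebra.Free_Abelian_Groups"
begin

section \<open>Group presentations\<close>

text \<open>A letter \<open>(a, True)\<close> stands for the generator \<open>a\<close>, and \<open>(a, False)\<close> for its inverse.
  Relations are pairs of words (left-hand side and right-hand side).\<close>

type_synonym 'a word = "('a \<times> bool) list"

definition words :: "'a set \<Rightarrow> 'a word set" where
  "words S = lists (S \<times> UNIV)"

inductive_set word_cong :: "'a set \<Rightarrow> ('a word \<times> 'a word) set \<Rightarrow> ('a word \<times> 'a word) set"
  for S R where
  refl: "u \<in> words S \<Longrightarrow> (u, u) \<in> word_cong S R"
| sym: "(u, v) \<in> word_cong S R \<Longrightarrow> (v, u) \<in> word_cong S R"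
| trans: "(u, v) \<in> word_cong S R \<Longrightarrow> (v, w) \<in> word_cong S R \<Longrightarrow> (u, w) \<in> word_cong S R"
| cancel: "u \<in> words S \<Longrightarrow> v \<in> words S \<Longrightarrow> a \<in> S \<Longrightarrow>
    (u @ [(a, e), (a, \<not> e)] @ v, u @ v) \<in> word_cong S R"
| rel: "u \<in> words S \<Longrightarrow> v \<in> words S \<Longrightarrow> (l, l') \<in> R \<Longrightarrow> l \<in> words S \<Longrightarrow> l' \<in> words S \<Longrightarrow>
    (u @ l @ v, u @ l' @ v) \<in> word_cong S R"

definition presented_group :: "'a set \<Rightarrow> ('a word \<times> 'a word) set \<Rightarrow> 'a word set monoid" where
  "presented_group S R =
    \<lparr>carrier = words S // word_cong S R,
     monoid.mult = (\<lambda>A B. \<Union>u\<in>A. \<Union>v\<in>B. word_cong S R `` {u @ v}),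
     one = word_cong S R `` {[]}\<rparr>"

section \<open>Quandles\<close>

locale quandle =
  fixes Q :: "'a set" and tri :: "'a \<Rightarrow> 'a \<Rightarrow> 'a"
  assumes nonempty: "Q \<noteq> {}"
    and closed: "a \<in> Q \<Longrightarrow> b \<in> Q \<Longrightarrow> tri a b \<in> Q"
    and self_distrib: "a \<in> Q \<Longrightarrow> b \<in> Q \<Longrightarrow> c \<in> Q \<Longrightarrow> tri (tri a b) c = tri (tri a c) (tri b c)"
    and bij_translation: "b \<in> Q \<Longrightarrow> bij_betw (\<lambda>a. tri a b) Q Q"
    and idem: "a \<in> Q \<Longrightarrow> tri a a = a"

locale abelian_quandle = quandle +
  assumes abelian: "a \<in> Q \<Longrightarrow> b \<in> Q \<Longrightarrow> c \<in> Q \<Longrightarrow> tri (tri a b) c = tri (tri a c) b"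

definition translation_group :: "'a set \<Rightarrow> ('a \<Rightarrow> 'a \<Rightarrow> 'a) \<Rightarrow> ('a \<Rightarrow> 'a) monoid" where
  "translation_group Q tri =
    (BijGroup Q) \<lparr>carrier := generate (BijGroup Q) ((\<lambda>b. \<lambda>a\<in>Q. tri a b) ` Q)\<rparr>"

definition quandle_orbits :: "'a set \<Rightarrow> ('a \<Rightarrow> 'a \<Rightarrow> 'a) \<Rightarrow> 'a set set" where
  "quandle_orbits Q tri = orbits (translation_group Q tri) Q (\<lambda>g. g)"

definition quandle_iso ::
  "'a set \<Rightarrow> ('a \<Rightarrow> 'a \<Rightarrow> 'a) \<Rightarrow> 'b set \<Rightarrow> ('b \<Rightarrow> 'b \<Rightarrow> 'b) \<Rightarrow> ('a \<Rightarrow> 'b) set" where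
  "quandle_iso Q tri Y tri' =
    {f. bij_betw f Q Y \<and> (\<forall>a\<in>Q. \<forall>b\<in>Q. f (tri a b) = tri' (f a) (f b))}"

definition structure_group :: "'a set \<Rightarrow> ('a \<Rightarrow> 'a \<Rightarrow> 'a) \<Rightarrow> 'a word set monoid" where
  "structure_group Q tri = presented_group Q
    {([(a, True), (b, True)], [(b, True), (tri a b, True)]) | a b. a \<in> Q \<and> b \<in> Q}"

section \<open>Parameter collections\<close>

text \<open>A parameter collection is represented by a function of which only the values \<open>m i j\<close>
  with \<open>1 \<le> j \<le> i < r\<close> matter.\<close>

definition param_collection :: "nat \<Rightarrow> (nat \<Rightarrow> nat \<Rightarrow> int) \<Rightarrow> bool" where
  "param_collection r m \<longleftrightarrow>
    (\<forall>i\<in>{1..<r}. 1 \<le> m i i) \<and>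
    (\<forall>i\<in>{1..<r}. \<forall>j\<in>{1..<r}. i < j \<longrightarrow> 0 \<le> m j i \<and> m j i < m i i)"

text \<open>The group on pairwise commuting generators \<open>x\<^sub>1, \<dots>, x\<^bsub>r-1\<^esub>\<close> subject to the given relators is
  the quotient of the free abelian group on \<open>{1..<r}\<close> (written additively in the library) by the
  subgroup they generate.\<close>

definition param_relators :: "nat \<Rightarrow> (nat \<Rightarrow> nat \<Rightarrow> int) \<Rightarrow> (nat \<Rightarrow>\<^sub>0 int) set" where
  "param_relators r m = (\<lambda>i. \<Sum>k = 1..i. frag_cmul (m i k) (frag_of k)) ` {1..<r}"

definition param_subgroup :: "nat \<Rightarrow> (nat \<Rightarrow> nat \<Rightarrow> int) \<Rightarrow> (nat \<Rightarrow>\<^sub>0 int) set" where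
  "param_subgroup r m = generate (free_Abelian_group {1..<r}) (param_relators r m)"

definition GM :: "nat \<Rightarrow> (nat \<Rightarrow> nat \<Rightarrow> int) \<Rightarrow> (nat \<Rightarrow>\<^sub>0 int) set monoid" where
  "GM r m = free_Abelian_group {1..<r} Mod param_subgroup r m"

definition GM_gen :: "nat \<Rightarrow> (nat \<Rightarrow> nat \<Rightarrow> int) \<Rightarrow> nat \<Rightarrow> (nat \<Rightarrow>\<^sub>0 int) set" where
  "GM_gen r m k = (if k = 0 then \<one>\<^bsub>GM r m\<^esub>
     else param_subgroup r m #>\<^bsub>free_Abelian_group {1..<r}\<^esub> frag_of k)"

definition mod_diff :: "nat \<Rightarrow> nat \<Rightarrow> nat \<Rightarrow> nat" where
  "mod_diff r j i = nat ((int j - int i) mod int r)"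

text \<open>The \<open>i\<close>-th summand of the disjoint union consists of the pairs with first component \<open>i\<close>.\<close>

definition Q_carrier ::
  "nat \<Rightarrow> (nat \<Rightarrow> nat \<Rightarrow> nat \<Rightarrow> int) \<Rightarrow> (nat \<times> (nat \<Rightarrow>\<^sub>0 int) set) set" where
  "Q_carrier r M = (SIGMA i:{1..r}. carrier (GM r (M i)))"

definition Q_op ::
  "nat \<Rightarrow> (nat \<Rightarrow> nat \<Rightarrow> nat \<Rightarrow> int) \<Rightarrow>
    nat \<times> (nat \<Rightarrow>\<^sub>0 int) set \<Rightarrow> nat \<times> (nat \<Rightarrow>\<^sub>0 int) set \<Rightarrow> nat \<times> (nat \<Rightarrow>\<^sub>0 int) set" where
  "Q_op r M = (\<lambda>(i, a) (j, b).
     (i, a \<otimes>\<^bsub>GM r (M i)\<^esub> GM_gen r (M i) (mod_diff r j i)))"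

section \<open>Parameters and parameter group of a quandle with ordered orbits\<close>

definition is_parameters ::
  "'a set \<Rightarrow> ('a \<Rightarrow> 'a \<Rightarrow> 'a) \<Rightarrow> nat \<Rightarrow> (nat \<Rightarrow> 'a set) \<Rightarrow> (nat \<Rightarrow> nat \<Rightarrow> nat \<Rightarrow> int) \<Rightarrow> bool" where
  "is_parameters Q tri r orb M \<longleftrightarrow>
    (\<forall>i\<in>{1..r}. param_collection r (M i)) \<and>
    (\<exists>f \<in> quandle_iso Q tri (Q_carrier r M) (Q_op r M).
       \<forall>i\<in>{1..r}. f ` orb i = {i} \<times> carrier (GM r (M i)))"

text \<open>For a finite abelian quandle parameters exist, and their values \<open>M l i j\<close> with \<open>1 \<le> l \<le> r\<close> and
  \<open>1 \<le> j \<le> i < r\<close> are unique. Only the irrelevant values outside this range are left to choice;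
  that is why \<open>SOME\<close> is used instead of \<open>THE\<close>.\<close>

definition quandle_parameters ::
  "'a set \<Rightarrow> ('a \<Rightarrow> 'a \<Rightarrow> 'a) \<Rightarrow> nat \<Rightarrow> (nat \<Rightarrow> 'a set) \<Rightarrow> (nat \<Rightarrow> nat \<Rightarrow> nat \<Rightarrow> int)" where
  "quandle_parameters Q tri r orb = (SOME M. is_parameters Q tri r orb M)"

definition GM_product ::
  "nat \<Rightarrow> (nat \<Rightarrow> nat \<Rightarrow> nat \<Rightarrow> int) \<Rightarrow> (nat \<Rightarrow> (nat \<Rightarrow>\<^sub>0 int) set) monoid" where
  "GM_product r M = product_group {1..r} (\<lambda>i. GM r (M i))"

definition product_gen ::
  "nat \<Rightarrow> (nat \<Rightarrow> nat \<Rightarrow> nat \<Rightarrow> int) \<Rightarrow> nat \<Rightarrow> nat \<Rightarrow> (nat \<Rightarrow> (nat \<Rightarrow>\<^sub>0 int) set)" where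
  "product_gen r M i k =
    (\<lambda>l\<in>{1..r}. if l = i then GM_gen r (M i) k else \<one>\<^bsub>GM r (M l)\<^esub>)"

definition param_quotient ::
  "nat \<Rightarrow> (nat \<Rightarrow> nat \<Rightarrow> nat \<Rightarrow> int) \<Rightarrow> (nat \<Rightarrow> (nat \<Rightarrow>\<^sub>0 int) set) set monoid" where
  "param_quotient r M = GM_product r M Mod generate (GM_product r M)
    {product_gen r M i (mod_diff r j i) \<otimes>\<^bsub>GM_product r M\<^esub> product_gen r M j (mod_diff r i j)
      | i j. 1 \<le> i \<and> i < j \<and> j \<le> r}"

definition parameter_group ::
  "'a set \<Rightarrow> ('a \<Rightarrow> 'a \<Rightarrow> 'a) \<Rightarrow> nat \<Rightarrow> (nat \<Rightarrow> 'a set) \<Rightarrow> (nat \<Rightarrow> (nat \<Rightarrow>\<^sub>0 int) set) set monoid" where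
  "parameter_group Q tri r orb = param_quotient r (quandle_parameters Q tri r orb)"

section \<open>Central extensions\<close>

text \<open>The library's \<open>short_exact_sequence\<close> forces the three groups to have the same element
  type, so it cannot be used here.\<close>

definition short_exact ::
  "('a, 'm) monoid_scheme \<Rightarrow> ('b, 'n) monoid_scheme \<Rightarrow> ('c, 'k) monoid_scheme \<Rightarrow>
    ('a \<Rightarrow> 'b) \<Rightarrow> ('b \<Rightarrow> 'c) \<Rightarrow> bool" where
  "short_exact A G B \<iota> \<pi> \<longleftrightarrow>
    group_hom A G \<iota> \<and> group_hom G B \<pi> \<and> inj_on \<iota> (carrier A) \<and>
    \<iota> ` carrier A = kernel G B \<pi> \<and> \<pi> ` carrier G = carrier B"

definition is_central_extension ::
  "('b, 'n) monoid_scheme \<Rightarrow> ('c, 'k) monoid_scheme \<Rightarrow> ('a, 'm) monoid_scheme \<Rightarrow> bool" where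
  "is_central_extension G B A \<longleftrightarrow>
    (\<exists>\<iota> \<pi>. short_exact A G B \<iota> \<pi> \<and>
      (\<forall>z \<in> \<iota> ` carrier A. \<forall>g \<in> carrier G. z \<otimes>\<^bsub>G\<^esub> g = g \<otimes>\<^bsub>G\<^esub> z))"

end

theory Submission
  imports Defs
begin

text \<open>In an abelian quandle right translation by \<open>b\<close> depends only on the orbit of \<open>b\<close>. Hence
  \<open>g\<^sub>b\<^sup>-\<^sup>1 g\<^sub>a g\<^sub>b = g\<^bsub>a \<triangleleft> b\<^esub>\<close> shows that the commutator of \<open>g\<^sub>a\<close> and \<open>g\<^sub>b\<close> depends only on the
  orbits of \<open>a\<close> and \<open>b\<close>, and conjugating once more that it is central. If \<open>e\<close> denotes the neutral element
  of an orbit \<open>G(M\<^sup>i)\<close>, the map \<open>t \<mapsto> g\<^sub>e\<^sup>-\<^sup>1 g\<^sub>t\<close> is therefore a homomorphism into the central commutators,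
  and these maps combine to a homomorphism from the parameter group onto the commutator
  subgroup, which is also the kernel of the abelianisation \<open>G \<rightarrow> \<int>\<^sup>r\<close>. Injectivity is seen by letting
  \<open>G\<close> act on an explicit central extension of \<open>\<int>\<^sup>r\<close> by the parameter group.

  Parameters exist because each orbit is a transitive set for \<open>\<int>\<^bsup>r-1\<^esup>\<close>, and the stabiliser, a
  subgroup of finite index, has a basis in Hermite normal form.\<close>

section \<open>Presented groups\<close>

text \<open>The kernel to be detected consists of commutators, so no commutative target can separate
  its elements. A group is needed in which the commutators of the lifts of the unit vectors are the
  prescribed c_ij, the classes of x_{j-i} from orbit i in the parameter group. Such a pairing is the
  antisymmetrisation of a bilinear cocycle. Halving c is impossible in general because of elements
  of even order, so the cocycle keeps c_ij for i < j and is trivial otherwise. This produces the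
  right commutator for i < j, and for i > j it does so exactly because c_ij c_ji = 1, which is what
  the relators of the parameter group say. The extension is never constructed as a group. Its left
  translations are permutations of the underlying set, so associativity and inverses come from the
  symmetric group and only the relation between two generators has to be verified.\<close>

lemma words_append [simp]: "u @ v \<in> words S \<longleftrightarrow> u \<in> words S \<and> v \<in> words S"
  by (auto simp: words_def)

lemma words_Nil [simp]: "[] \<in> words S"
  by (simp add: words_def)

lemma words_Cons [simp]: "(a, e) # w \<in> words S \<longleftrightarrow> a \<in> S \<and> w \<in> words S"
  by (auto simp: words_def)

lemma word_cong_words: "(u, v) \<in> word_cong S R \<Longrightarrow> u \<in> words S \<and> v \<in> words S"
  by (induction rule: word_cong.induct) auto

text \<open>Compatibility with concatenation is not among the rules of \<open>word_cong\<close>. It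
  comes from the contexts \<open>u\<close> and \<open>v\<close> in \<open>cancel\<close> and
  \<open>rel\<close>, which absorb \<open>p\<close> and \<open>q\<close>.\<close>

lemma word_cong_context:
  assumes "(u, v) \<in> word_cong S R" "p \<in> words S" "q \<in> words S"
  shows "(p @ u @ q, p @ v @ q) \<in> word_cong S R"
  using assms
proof (induction rule: word_cong.induct)
  case (cancel u v a e)
  then show ?case
    using word_cong.cancel[of "p @ u" S "v @ q" a e R] by simp
next
  case (rel u v l l')
  then show ?case
    using word_cong.rel[of "p @ u" S "v @ q" l l' R] by simp
qed (auto intro: word_cong.intros)

lemma word_cong_append:
  assumes "(u, u') \<in> word_cong S R" "(v, v') \<in> word_cong S R"
  shows "(u @ v, u' @ v') \<in> word_cong S R"
proof -
  have "u' \<in> words S" "v \<in> words S"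
    using assms word_cong_words by blast+
  then have "(u @ v, u' @ v) \<in> word_cong S R" "(u' @ v, u' @ v') \<in> word_cong S R"
    using word_cong_context[OF assms(1), of "[]" v] word_cong_context[OF assms(2), of u' "[]"]
    by simp_all
  then show ?thesis
    by (rule word_cong.trans)
qed

lemma equiv_word_cong: "equiv (words S) (word_cong S R)"
proof (rule equivI)
  show "word_cong S R \<subseteq> words S \<times> words S"
    using word_cong_words by fastforce
  show "refl_on (words S) (word_cong S R)"
    using word_cong_words by (fastforce simp: refl_on_def intro: word_cong.refl)
qed (auto intro: symI transI word_cong.sym word_cong.trans)

definition word_class :: "'a set \<Rightarrow> ('a word \<times> 'a word) set \<Rightarrow> 'a word \<Rightarrow> 'a word set" where
  "word_class S R u = word_cong S R `` {u}"

lemma carrier_presented_group: "carrier (presented_group S R) = word_class S R ` words S"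
  by (auto simp: presented_group_def quotient_def word_class_def)

lemma one_presented_group: "\<one>\<^bsub>presented_group S R\<^esub> = word_class S R []"
  by (simp add: presented_group_def word_class_def)

lemma word_class_eq_iff:
  "u \<in> words S \<Longrightarrow> v \<in> words S \<Longrightarrow> word_class S R u = word_class S R v \<longleftrightarrow> (u, v) \<in> word_cong S R"
  unfolding word_class_def by (rule eq_equiv_class_iff[OF equiv_word_cong])

lemma mult_presented_group:
  assumes "u \<in> words S" "v \<in> words S"
  shows "word_class S R u \<otimes>\<^bsub>presented_group S R\<^esub> word_class S R v = word_class S R (u @ v)"
proof -
  have "(\<lambda>u v. word_cong S R `` {u @ v}) respects2 (word_cong S R)"
    unfolding congruent2_def
    by (auto intro!: equiv_class_eq[OF equiv_word_cong] word_cong_append)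
  then show ?thesis
    using UN_equiv_class2[OF equiv_word_cong equiv_word_cong _ assms(1,2)]
    by (simp add: presented_group_def word_class_def)
qed

definition inv_word :: "'a word \<Rightarrow> 'a word" where
  "inv_word w = rev (map (\<lambda>(a, e). (a, \<not> e)) w)"

lemma inv_word_words: "w \<in> words S \<Longrightarrow> inv_word w \<in> words S"
  by (auto simp: inv_word_def words_def)

lemma inv_word_append_cong: "w \<in> words S \<Longrightarrow> (inv_word w @ w, []) \<in> word_cong S R"
proof (induction w)
  case Nil
  then show ?case
    by (simp add: inv_word_def word_cong.refl)
next
  case (Cons x w)
  obtain a e where x: "x = (a, e)"
    by force
  have w: "w \<in> words S" "a \<in> S"
    using Cons.prems by (simp_all add: x)
  have "(inv_word w @ [(a, \<not> e), (a, \<not> \<not> e)] @ w, inv_word w @ w) \<in> word_cong S R"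
    by (rule word_cong.cancel) (use w inv_word_words in auto)
  then show ?case
    using Cons.IH w word_cong.trans by (fastforce simp: x inv_word_def)
qed

lemma group_presented_group: "group (presented_group S R)"
proof (rule groupI)
  fix x assume "x \<in> carrier (presented_group S R)"
  then obtain u where u: "u \<in> words S" "x = word_class S R u"
    by (auto simp: carrier_presented_group)
  then have "word_class S R (inv_word u) \<otimes>\<^bsub>presented_group S R\<^esub> x = \<one>\<^bsub>presented_group S R\<^esub>"
    by (simp add: mult_presented_group inv_word_words one_presented_group word_class_eq_iff
        inv_word_append_cong)
  then show "\<exists>y\<in>carrier (presented_group S R). y \<otimes>\<^bsub>presented_group S R\<^esub> x = \<one>\<^bsub>presented_group S R\<^esub>"
    using u inv_word_words by (force simp: carrier_presented_group)
qed (auto simp: carrier_presented_group one_presented_group mult_presented_group)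

definition presented_gen :: "'a set \<Rightarrow> ('a word \<times> 'a word) set \<Rightarrow> 'a \<Rightarrow> 'a word set" where
  "presented_gen S R a = word_class S R [(a, True)]"

lemma presented_gen_closed: "a \<in> S \<Longrightarrow> presented_gen S R a \<in> carrier (presented_group S R)"
  by (auto simp: presented_gen_def carrier_presented_group)

lemma inv_presented_gen:
  assumes "a \<in> S"
  shows "inv\<^bsub>presented_group S R\<^esub> presented_gen S R a = word_class S R [(a, False)]"
proof (rule group.inv_equality[OF group_presented_group])
  show "word_class S R [(a, False)] \<otimes>\<^bsub>presented_group S R\<^esub> presented_gen S R a
      = \<one>\<^bsub>presented_group S R\<^esub>"
    using assms word_cong.cancel[of "[]" S "[]" a False R]
    by (simp add: presented_gen_def mult_presented_group one_presented_group word_class_eq_iff)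
qed (use assms in \<open>auto simp: presented_gen_def carrier_presented_group\<close>)

lemma generate_presented_gen:
  "generate (presented_group S R) (presented_gen S R ` S) = carrier (presented_group S R)"
proof
  show "generate (presented_group S R) (presented_gen S R ` S) \<subseteq> carrier (presented_group S R)"
    by (intro group.generate_incl group_presented_group) (auto simp: presented_gen_closed)
next
  have "word_class S R w \<in> generate (presented_group S R) (presented_gen S R ` S)"
    if "w \<in> words S" for w
    using that
  proof (induction w)
    case Nil
    then show ?case
      by (simp flip: one_presented_group add: generate.one)
  next
    case (Cons x w)
    obtain a e where x: "x = (a, e)"
      by force
    have w: "w \<in> words S" "a \<in> S"
      using Cons.prems by (simp_all add: x)
    have "word_class S R [(a, e)] \<in> generate (presented_group S R) (presented_gen S R ` S)"
    proof (cases e)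
      case True
      then show ?thesis
        using w generate.incl[of "presented_gen S R a" "presented_gen S R ` S" "presented_group S R"]
        by (simp add: presented_gen_def)
    next
      case False
      then show ?thesis
        using generate.inv[of "presented_gen S R a" "presented_gen S R ` S" "presented_group S R"] w
        by (simp add: inv_presented_gen)
    qed
    then show ?case
      using generate.eng[OF _ Cons.IH[OF w(1)], of "word_class S R [(a, e)]"] w
      by (simp add: mult_presented_group x)
  qed
  then show "carrier (presented_group S R)
      \<subseteq> generate (presented_group S R) (presented_gen S R ` S)"
    by (auto simp: carrier_presented_group)
qed

section \<open>Universal property of a presented group\<close>

fun word_eval :: "('b, 'm) monoid_scheme \<Rightarrow> ('a \<Rightarrow> 'b) \<Rightarrow> 'a word \<Rightarrow> 'b" where
  "word_eval H f [] = \<one>\<^bsub>H\<^esub>"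
| "word_eval H f ((a, e) # w) = (if e then f a else inv\<^bsub>H\<^esub> f a) \<otimes>\<^bsub>H\<^esub> word_eval H f w"

lemma (in group) word_eval_closed:
  "f \<in> S \<rightarrow> carrier G \<Longrightarrow> w \<in> words S \<Longrightarrow> word_eval G f w \<in> carrier G"
  by (induction w) (auto simp: Pi_iff)

lemma (in group) word_eval_append:
  assumes "f \<in> S \<rightarrow> carrier G" "u \<in> words S" "v \<in> words S"
  shows "word_eval G f (u @ v) = word_eval G f u \<otimes> word_eval G f v"
  using assms
proof (induction u)
  case (Cons x u)
  moreover obtain a e where "x = (a, e)"
    by force
  moreover have "word_eval G f u \<in> carrier G" "word_eval G f v \<in> carrier G"
    using Cons word_eval_closed[of f S] calculation by auto
  ultimately show ?case
    by (auto simp: Pi_iff m_assoc)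
qed (use word_eval_closed[of f S] in auto)

lemma (in group) word_eval_cong:
  assumes "(u, v) \<in> word_cong S R" "f \<in> S \<rightarrow> carrier G"
    and "\<And>l l'. (l, l') \<in> R \<Longrightarrow> l \<in> words S \<Longrightarrow> l' \<in> words S \<Longrightarrow> word_eval G f l = word_eval G f l'"
  shows "word_eval G f u = word_eval G f v"
  using assms(1)
proof (induction rule: word_cong.induct)
  case (cancel u v a e)
  then have "word_eval G f [(a, e), (a, \<not> e)] = \<one>"
    using assms(2) by (auto simp: Pi_iff)
  then show ?case
    using cancel assms(2) word_eval_closed[of f S]
      word_eval_append[of f S u "[(a, e), (a, \<not> e)] @ v"]
      word_eval_append[of f S "[(a, e), (a, \<not> e)]" v] word_eval_append[of f S u v]
    by simp
next
  case (rel u v l l')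
  then show ?case
    using assms(2,3) word_eval_append[of f S] by simp
qed auto

lemma (in group) presented_group_universal:
  assumes f: "f \<in> S \<rightarrow> carrier G"
    and "\<And>l l'. (l, l') \<in> R \<Longrightarrow> l \<in> words S \<Longrightarrow> l' \<in> words S \<Longrightarrow> word_eval G f l = word_eval G f l'"
  obtains h where "h \<in> hom (presented_group S R) G"
    and "\<And>a. a \<in> S \<Longrightarrow> h (presented_gen S R a) = f a"
proof -
  have cong: "word_eval G f u = word_eval G f v" if "(u, v) \<in> word_cong S R" for u v
    using that assms by (rule word_eval_cong)
  \<comment> \<open>Evaluation is constant on congruence classes, so it factors through the
    class.\<close>
  have "\<exists>h. \<forall>w. w \<in> words S \<longrightarrow> word_eval G f w = h (word_class S R w)"
    unfolding function_factors_left_gen[symmetric] using cong by (auto simp: word_class_eq_iff)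
  then obtain h where h: "\<And>w. w \<in> words S \<Longrightarrow> h (word_class S R w) = word_eval G f w"
    by metis
  show thesis
  proof
    show "h \<in> hom (presented_group S R) G"
      using f by (intro homI)
        (auto simp: carrier_presented_group mult_presented_group h word_eval_append word_eval_closed)
    show "h (presented_gen S R a) = f a" if "a \<in> S" for a
      using that f by (auto simp: presented_gen_def h Pi_iff)
  qed
qed

section \<open>Homomorphisms out of direct products\<close>

lemma (in comm_group) finprod_in_hom:
  assumes I: "finite I" and h: "\<And>i. i \<in> I \<Longrightarrow> h i \<in> hom (A i) G"
  shows "(\<lambda>x. \<Otimes>i\<in>I. h i (x i)) \<in> hom (product_group I A) G"
proof (rule homI)
  fix x y assume xy: "x \<in> carrier (product_group I A)" "y \<in> carrier (product_group I A)"
  have c: "(\<lambda>i. h i (x i)) \<in> I \<rightarrow> carrier G" "(\<lambda>i. h i (y i)) \<in> I \<rightarrow> carrier G"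
    using h xy by (fastforce simp: hom_def PiE_iff)+
  then have "(\<Otimes>i\<in>I. h i (x i) \<otimes> h i (y i)) = (\<Otimes>i\<in>I. h i (x i)) \<otimes> (\<Otimes>i\<in>I. h i (y i))"
    by simp
  moreover have "(\<Otimes>i\<in>I. h i ((x \<otimes>\<^bsub>product_group I A\<^esub> y) i)) = (\<Otimes>i\<in>I. h i (x i) \<otimes> h i (y i))"
    by (rule finprod_cong') (use c xy h in \<open>auto simp: PiE_iff Pi_iff hom_mult\<close>)
  ultimately show "(\<Otimes>i\<in>I. h i ((x \<otimes>\<^bsub>product_group I A\<^esub> y) i))
      = (\<Otimes>i\<in>I. h i (x i)) \<otimes> (\<Otimes>i\<in>I. h i (y i))"
    by simp
next
  fix x assume "x \<in> carrier (product_group I A)"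
  then show "(\<Otimes>i\<in>I. h i (x i)) \<in> carrier G"
    using h by (intro finprod_closed) (fastforce simp: hom_def PiE_iff)
qed

definition product_single ::
  "'i set \<Rightarrow> ('i \<Rightarrow> ('b, 'm) monoid_scheme) \<Rightarrow> 'i \<Rightarrow> 'b \<Rightarrow> 'i \<Rightarrow> 'b" where
  "product_single I A i a = (\<lambda>l\<in>I. if l = i then a else \<one>\<^bsub>A l\<^esub>)"

lemma product_single_closed:
  assumes "\<And>i. i \<in> I \<Longrightarrow> group (A i)" "a \<in> carrier (A i)"
  shows "product_single I A i a \<in> carrier (product_group I A)"
  using assms by (auto simp: product_single_def group.is_monoid)

text \<open>An element of a finite product is the product of its coordinates, collected over a
  growing index set \<open>J\<close>.\<close>

lemma generate_product_single:
  assumes I: "finite I" and A: "\<And>i. i \<in> I \<Longrightarrow> group (A i)"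
  shows "generate (product_group I A) (\<Union>i\<in>I. product_single I A i ` carrier (A i))
    = carrier (product_group I A)" (is "generate ?P ?S = _")
proof
  show "generate ?P ?S \<subseteq> carrier ?P"
    using A product_single_closed[OF A] by (intro group.generate_incl) (auto simp del: carrier_product_group)
next
  show "carrier ?P \<subseteq> generate ?P ?S"
  proof
    fix x assume x: "x \<in> carrier ?P"
    have "(\<lambda>i\<in>I. if i \<in> J then x i else \<one>\<^bsub>A i\<^esub>) \<in> generate ?P ?S" if "finite J" "J \<subseteq> I" for J
      using that
    proof (induction J rule: finite_induct)
      case empty
      then show ?case
        using generate.one[of ?P ?S] by (simp add: restrict_def)
    next
      case (insert j J)
      have j: "x j \<in> carrier (A j)" "j \<in> I"
        using insert.prems x by (auto simp: PiE_iff)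
      have "(\<lambda>i\<in>I. if i \<in> insert j J then x i else \<one>\<^bsub>A i\<^esub>)
          = product_single I A j (x j) \<otimes>\<^bsub>?P\<^esub> (\<lambda>i\<in>I. if i \<in> J then x i else \<one>\<^bsub>A i\<^esub>)"
        using insert.hyps A x j
        by (auto simp: product_single_def fun_eq_iff group.is_monoid monoid.l_one monoid.r_one PiE_iff)
      moreover have "product_single I A j (x j) \<in> generate ?P ?S"
        using j by (intro generate.incl) blast
      ultimately show ?case
        using insert by (simp only: generate.eng insert_subset)
    qed
    moreover have "(\<lambda>i\<in>I. if i \<in> I then x i else \<one>\<^bsub>A i\<^esub>) = x"
      using x by (auto simp: PiE_iff extensional_def)
    ultimately show "x \<in> generate ?P ?S"
      using I by force
  qed
qed

lemma product_single_hom: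
  assumes "\<And>i. i \<in> I \<Longrightarrow> group (A i)" "i \<in> I"
  shows "product_single I A i \<in> hom (A i) (product_group I A)"
proof (rule homI)
  fix a b assume "a \<in> carrier (A i)" "b \<in> carrier (A i)"
  then show "product_single I A i (a \<otimes>\<^bsub>A i\<^esub> b)
      = product_single I A i a \<otimes>\<^bsub>product_group I A\<^esub> product_single I A i b"
    using assms by (auto simp: product_single_def fun_eq_iff group.is_monoid monoid.l_one)
next
  fix a assume "a \<in> carrier (A i)"
  then show "product_single I A i a \<in> carrier (product_group I A)"
    by (intro product_single_closed assms(1))
qed

lemma comm_group_product_group:
  assumes "\<And>i. i \<in> I \<Longrightarrow> comm_group (A i)"
  shows "comm_group (product_group I A)"
proof (rule group.group_comm_groupI)
  show "group (product_group I A)"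
    using assms by (simp add: comm_group.axioms)
  fix x y assume "x \<in> carrier (product_group I A)" "y \<in> carrier (product_group I A)"
  then show "x \<otimes>\<^bsub>product_group I A\<^esub> y = y \<otimes>\<^bsub>product_group I A\<^esub> x"
    using comm_groupE(4)[OF assms] by (auto simp: PiE_iff intro!: restrict_ext)
qed

lemma (in comm_group) finprod_product_single:
  assumes I: "finite I" "i \<in> I" and A: "\<And>i. i \<in> I \<Longrightarrow> group (A i)"
    and h: "\<And>i. i \<in> I \<Longrightarrow> h i \<in> hom (A i) G" and a: "a \<in> carrier (A i)"
  shows "(\<Otimes>l\<in>I. h l (product_single I A i a l)) = h i a"
proof -
  have c: "h i a \<in> carrier G"
    using h I a by (auto simp: hom_def)
  have "(\<Otimes>l\<in>I. h l (product_single I A i a l)) = (\<Otimes>l\<in>I. if i = l then h i a else \<one>)"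
    by (rule finprod_cong)
      (use I A h c in \<open>auto simp: product_single_def simp_implies_def hom_one[OF h] is_group\<close>)
  then show ?thesis
    using finprod_singleton[OF I(2,1), of "\<lambda>_. h i a"] c by simp
qed

section \<open>Generators, centre and commutators\<close>

lemma (in group_hom) hom_eq_on_generate:
  assumes "group_hom G H k" "S \<subseteq> carrier G" "\<And>a. a \<in> S \<Longrightarrow> h a = k a" "x \<in> generate G S"
  shows "h x = k x"
proof -
  interpret k: group_hom G H k
    by fact
  show ?thesis
    using assms(4)
  proof (induction x rule: generate.induct)
    case (inv a)
    then show ?case
      using assms(2,3) by (metis hom_inv k.hom_inv subsetD)
  next
    case (eng a b)
    then show ?case
      using G.generate_in_carrier[OF assms(2)] by simp
  qed (use assms(3) in auto)
qed

definition center :: "('a, 'm) monoid_scheme \<Rightarrow> 'a set" where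
  "center G = {z \<in> carrier G. \<forall>g\<in>carrier G. z \<otimes>\<^bsub>G\<^esub> g = g \<otimes>\<^bsub>G\<^esub> z}"

text \<open>Serves twice: \<open>X = carrier G\<close> gives the centre, and \<open>X = {z}\<close>
  reduces the centrality of \<open>z\<close> to generators.\<close>

lemma (in group) commutant_subgroup:
  assumes "X \<subseteq> carrier G"
  shows "subgroup {z \<in> carrier G. \<forall>g\<in>X. z \<otimes> g = g \<otimes> z} G"
proof (rule subgroupI)
  fix z assume z: "z \<in> {z \<in> carrier G. \<forall>g\<in>X. z \<otimes> g = g \<otimes> z}"
  have "inv z \<otimes> g = g \<otimes> inv z" if "g \<in> X" for g
  proof -
    have g: "g \<in> carrier G"
      using that assms by blast
    then have "inv z \<otimes> g = inv z \<otimes> (g \<otimes> z) \<otimes> inv z"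
      using z by (simp add: m_assoc)
    also have "\<dots> = inv z \<otimes> (z \<otimes> g) \<otimes> inv z"
      using z that by simp
    also have "\<dots> = g \<otimes> inv z"
      using z g by (simp flip: m_assoc)
    finally show ?thesis .
  qed
  then show "inv z \<in> {z \<in> carrier G. \<forall>g\<in>X. z \<otimes> g = g \<otimes> z}"
    using z by simp
next
  fix z w assume zw: "z \<in> {z \<in> carrier G. \<forall>g\<in>X. z \<otimes> g = g \<otimes> z}"
    "w \<in> {z \<in> carrier G. \<forall>g\<in>X. z \<otimes> g = g \<otimes> z}"
  have "z \<otimes> w \<otimes> g = g \<otimes> (z \<otimes> w)" if "g \<in> X" for g
  proof -
    have g: "g \<in> carrier G"
      using that assms by blast
    have "z \<otimes> w \<otimes> g = z \<otimes> (w \<otimes> g)"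
      using zw g by (simp add: m_assoc)
    also have "\<dots> = z \<otimes> (g \<otimes> w)"
      using zw that by simp
    also have "\<dots> = (z \<otimes> g) \<otimes> w"
      using zw g by (simp add: m_assoc)
    also have "\<dots> = (g \<otimes> z) \<otimes> w"
      using zw that by simp
    also have "\<dots> = g \<otimes> (z \<otimes> w)"
      using zw g by (simp add: m_assoc)
    finally show ?thesis .
  qed
  then show "z \<otimes> w \<in> {z \<in> carrier G. \<forall>g\<in>X. z \<otimes> g = g \<otimes> z}"
    using zw by simp
next
  have "\<one> \<in> {z \<in> carrier G. \<forall>g\<in>X. z \<otimes> g = g \<otimes> z}"
    using assms by auto
  then show "{z \<in> carrier G. \<forall>g\<in>X. z \<otimes> g = g \<otimes> z} \<noteq> {}"
    by blast
qed auto

lemma (in group) center_subgroup: "subgroup (center G) G"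
  using commutant_subgroup[of "carrier G"] by (simp add: center_def)

lemma (in group) center_generators:
  assumes S: "S \<subseteq> carrier G" "generate G S = carrier G"
    and z: "z \<in> carrier G" "\<And>a. a \<in> S \<Longrightarrow> z \<otimes> a = a \<otimes> z"
  shows "z \<in> center G"
proof -
  have "generate G S \<subseteq> {g \<in> carrier G. \<forall>h\<in>{z}. g \<otimes> h = h \<otimes> g}"
    by (rule generate_subgroup_incl[OF _ commutant_subgroup]) (use S z in auto)
  then show ?thesis
    using S z by (auto simp: center_def)
qed

text \<open>Each generator commutes with the generators and is therefore central; the centre is then
  a subgroup that contains all generators.\<close>

lemma (in group) comm_group_generators:
  assumes S: "S \<subseteq> carrier G" "generate G S = carrier G"
    and comm: "\<And>a b. a \<in> S \<Longrightarrow> b \<in> S \<Longrightarrow> a \<otimes> b = b \<otimes> a"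
  shows "comm_group G"
proof (rule group_comm_groupI)
  fix x y assume "x \<in> carrier G" "y \<in> carrier G"
  moreover have "S \<subseteq> center G"
    using center_generators[OF S] comm S(1) by blast
  then have "generate G S \<subseteq> center G"
    by (rule generate_subgroup_incl[OF _ center_subgroup])
  ultimately show "x \<otimes> y = y \<otimes> x"
    using S by (auto simp: center_def)
qed

lemma (in group) normal_central:
  assumes "subgroup N G" "N \<subseteq> center G"
  shows "N \<lhd> G"
proof -
  have "g \<otimes> n \<otimes> inv g \<in> N" if "g \<in> carrier G" "n \<in> N" for g n
  proof -
    have n: "n \<in> carrier G" "n \<otimes> g = g \<otimes> n"
      using that assms(2) by (auto simp: center_def)
    then have "g \<otimes> n \<otimes> inv g = n"
      using that by (simp add: m_assoc flip: n(2))
    then show ?thesis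
      using that by simp
  qed
  then show ?thesis
    using assms(1) by (auto simp: normal_inv_iff)
qed

lemma (in group) comm_group_central:
  assumes "subgroup N G" "N \<subseteq> center G"
  shows "comm_group (G\<lparr>carrier := N\<rparr>)"
proof (rule group.group_comm_groupI)
  show "group (G\<lparr>carrier := N\<rparr>)"
    by (rule subgroup_imp_group) fact
qed (use assms(2) in \<open>auto simp: center_def subset_iff\<close>)

lemma (in group) commutator_in_derived:
  assumes "x \<in> carrier G" "y \<in> carrier G"
  shows "inv x \<otimes> inv y \<otimes> x \<otimes> y \<in> derived G (carrier G)"
proof -
  \<comment> \<open>The elements of \<open>derived_set\<close> have the shape x y x^-1 y^-1, so the
    inverses of \<open>x\<close> and \<open>y\<close> are inserted.\<close>
  have "inv x \<otimes> inv y \<otimes> inv (inv x) \<otimes> inv (inv y) \<in> derived_set G (carrier G)"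
    using assms by blast
  then show ?thesis
    using assms by (simp add: derived_def generate.incl)
qed

lemma (in group_hom) derived_subset_kernel:
  assumes "comm_group H"
  shows "derived G (carrier G) \<subseteq> kernel G H h"
proof -
  have "h ` derived G (carrier G) = derived H (h ` carrier G)"
    by (simp add: derived_img)
  also have "\<dots> = {\<one>\<^bsub>H\<^esub>}"
    by (intro comm_group.derived_eq_singleton assms) auto
  finally show ?thesis
    using G.derived_in_carrier[of "carrier G"] by (auto simp: kernel_def)
qed

section \<open>Hermite normal form\<close>

lemma subgroup_free_Abelian_group:
  assumes "subgroup L (free_Abelian_group S)"
  shows "0 \<in> L"
    and "u \<in> L \<Longrightarrow> v \<in> L \<Longrightarrow> u + v \<in> L"
    and "u \<in> L \<Longrightarrow> v \<in> L \<Longrightarrow> u - v \<in> L"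
    and "v \<in> L \<Longrightarrow> frag_cmul c v \<in> L"
proof -
  interpret L: subgroup L "free_Abelian_group S"
    by fact
  show zero: "0 \<in> L"
    using L.one_closed by simp
  show add: "u \<in> L \<Longrightarrow> v \<in> L \<Longrightarrow> u + v \<in> L" for u v
    using L.m_closed[of u v] by simp
  show cmul: "frag_cmul c v \<in> L" if "v \<in> L" for c v
  proof -
    have "Poly_Mapping.keys v \<subseteq> S"
      using L.subset that by (metis carrier_free_Abelian_group_iff subsetD)
    moreover have "v [^]\<^bsub>free_Abelian_group S\<^esub> c \<in> L"
      by (intro group.subgroup_int_pow_closed[OF group_free_Abelian_group L.subgroup_axioms] that)
    ultimately show ?thesis
      by simp
  qed
  show "u \<in> L \<Longrightarrow> v \<in> L \<Longrightarrow> u - v \<in> L"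
    using add[of u "frag_cmul (-1) v"] cmul[of v "-1"] by simp
qed

lemma frag_expansion_atMost:
  fixes v :: "nat \<Rightarrow>\<^sub>0 int"
  assumes "Poly_Mapping.keys v \<subseteq> {1..k}"
  shows "(\<Sum>j = 1..k. frag_cmul (poly_mapping.lookup v j) (frag_of j)) = v"
proof -
  have "(\<Sum>j = 1..k. frag_cmul (poly_mapping.lookup v j) (frag_of j))
      = (\<Sum>j \<in> Poly_Mapping.keys v. frag_cmul (poly_mapping.lookup v j) (frag_of j))"
    using assms by (intro sum.mono_neutral_right) (auto simp: in_keys_iff)
  then show ?thesis
    using frag_expansion[of v] by (simp add: frag_extend_def)
qed

text \<open>The \<open>k\<close>-th coefficients of the elements of \<open>L\<close> supported on
  \<open>{1..k}\<close> form an ideal of the integers. The multiple \<open>c\<close> of the basis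
  vector makes it nonzero, and division with remainder shows that its least positive element
  generates it.\<close>

lemma hermite_leading_coefficient:
  assumes L: "subgroup L (free_Abelian_group {1..<r})"
    and c: "c > 0" "frag_cmul c (frag_of k) \<in> L" and k: "k \<ge> 1"
  obtains w :: "nat \<Rightarrow>\<^sub>0 int" where "w \<in> L" "Poly_Mapping.keys w \<subseteq> {1..k}"
    "poly_mapping.lookup w k > 0"
    "\<And>v. v \<in> L \<Longrightarrow> Poly_Mapping.keys v \<subseteq> {1..k} \<Longrightarrow> poly_mapping.lookup w k dvd poly_mapping.lookup v k"
proof -
  let ?P = "\<lambda>d::nat. d > 0 \<and> (\<exists>w\<in>L. Poly_Mapping.keys w \<subseteq> {1..k} \<and> poly_mapping.lookup w k = int d)"
  have "?P (nat c)"
  proof (intro conjI bexI)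
    show "Poly_Mapping.keys (frag_cmul c (frag_of k)) \<subseteq> {1..k}"
      using k keys_cmul[of c "frag_of k"] by auto
    show "poly_mapping.lookup (frag_cmul c (frag_of k)) k = int (nat c)"
      using c by simp
  qed (use c in auto)
  then have "?P (LEAST d. ?P d)"
    by (rule LeastI)
  then obtain w where w: "w \<in> L" "Poly_Mapping.keys w \<subseteq> {1..k}"
      "poly_mapping.lookup w k = int (LEAST d. ?P d)" and pos: "(LEAST d. ?P d) > 0"
    by blast
  show thesis
  proof
    show "poly_mapping.lookup w k > 0"
      using w pos by simp
    fix v assume v: "v \<in> L" "Poly_Mapping.keys v \<subseteq> {1..k}"
    define m where "m = poly_mapping.lookup v k mod poly_mapping.lookup w k"
    define u where "u = v - frag_cmul (poly_mapping.lookup v k div poly_mapping.lookup w k) w"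
    have m: "0 \<le> m" "m < poly_mapping.lookup w k"
      using w pos by (simp_all add: m_def)
    have u: "u \<in> L" "Poly_Mapping.keys u \<subseteq> {1..k}" "poly_mapping.lookup u k = m"
      using subgroup_free_Abelian_group[OF L] v w keys_diff[of v] keys_cmul
      by (fastforce simp: u_def m_def lookup_minus minus_div_mult_eq_mod)+
    show "poly_mapping.lookup w k dvd poly_mapping.lookup v k"
    proof (rule ccontr)
      assume "\<not> ?thesis"
      then have "m \<noteq> 0"
        by (simp add: m_def dvd_eq_mod_eq_0)
      then have "?P (nat m)"
        using u m by auto
      then have "(LEAST d. ?P d) \<le> nat m"
        by (rule Least_le)
      then show False
        using m w(3) by linarith
    qed
  qed (use w in auto)
qed

text \<open>Coordinates are reduced from \<open>k - 1\<close> downwards: subtracting a multiple of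
  \<open>w j\<close> changes nothing above \<open>j\<close>, so what has been reduced stays reduced.
  The number \<open>t\<close> counts the coordinates already treated.\<close>

lemma hermite_reduce:
  fixes w :: "nat \<Rightarrow> nat \<Rightarrow>\<^sub>0 int"
  assumes L: "subgroup L (free_Abelian_group {1..<r})" and k: "k \<in> {1..<r}"
    and w: "\<And>i. i \<in> {1..<r} \<Longrightarrow> w i \<in> L \<and> Poly_Mapping.keys (w i) \<subseteq> {1..i} \<and> poly_mapping.lookup (w i) i > 0"
  shows "\<exists>v\<in>L. Poly_Mapping.keys v \<subseteq> {1..k} \<and> poly_mapping.lookup v k = poly_mapping.lookup (w k) k \<and>
    (\<forall>i\<in>{1..<k}. k \<le> i + t \<longrightarrow> 0 \<le> poly_mapping.lookup v i \<and> poly_mapping.lookup v i < poly_mapping.lookup (w i) i)"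
proof (induction t)
  case 0
  show ?case
    using w[OF k] by auto
next
  case (Suc t)
  then obtain v where v: "v \<in> L" "Poly_Mapping.keys v \<subseteq> {1..k}"
      "poly_mapping.lookup v k = poly_mapping.lookup (w k) k"
      "\<And>i. i \<in> {1..<k} \<Longrightarrow> k \<le> i + t \<Longrightarrow>
        0 \<le> poly_mapping.lookup v i \<and> poly_mapping.lookup v i < poly_mapping.lookup (w i) i"
    by blast
  show ?case
  proof (cases "Suc t < k")
    \<comment> \<open>Nothing is left to reduce: for \<open>i \<ge> 1\<close> the inequality
      \<open>k \<le> i + t\<close> already holds.\<close>
    case False
    then show ?thesis
      using v by (intro bexI[of _ v]) auto
  next
    case True
    define j where "j = k - Suc t"
    have j: "j \<in> {1..<r}" "j < k" "k = j + Suc t"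
      using True k by (auto simp: j_def)
    note wj = w[OF j(1)]
    define u where "u = v - frag_cmul (poly_mapping.lookup v j div poly_mapping.lookup (w j) j) (w j)"
    have beyond: "poly_mapping.lookup (w j) i = 0" if "i > j" for i
      using wj that by (auto simp: in_keys_iff[symmetric] simp flip: not_in_keys_iff_lookup_eq_zero)
    show ?thesis
    proof (intro bexI[of _ u] conjI ballI impI)
      show "u \<in> L"
        using subgroup_free_Abelian_group[OF L] v wj by (simp add: u_def)
      show "Poly_Mapping.keys u \<subseteq> {1..k}"
        using v(2) wj j(2) keys_diff[of v] keys_cmul unfolding u_def by fastforce
      show "poly_mapping.lookup u k = poly_mapping.lookup (w k) k"
        using v(3) beyond[OF j(2)] by (simp add: u_def lookup_minus)
      fix i assume i: "i \<in> {1..<k}" "k \<le> i + Suc t"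
      have "0 \<le> poly_mapping.lookup u i \<and> poly_mapping.lookup u i < poly_mapping.lookup (w i) i"
      proof (cases "i = j")
        case True
        then have "poly_mapping.lookup u i = poly_mapping.lookup v j mod poly_mapping.lookup (w j) j"
          by (simp add: u_def lookup_minus minus_div_mult_eq_mod)
        then show ?thesis
          using wj True by simp
      next
        case False
        then have "i > j"
          using i j by linarith
        then have "poly_mapping.lookup u i = poly_mapping.lookup v i"
          using beyond by (simp add: u_def lookup_minus)
        then show ?thesis
          using v(4) i False j by auto
      qed
      then show "0 \<le> poly_mapping.lookup u i" "poly_mapping.lookup u i < poly_mapping.lookup (w i) i"
        by simp_all
    qed
  qed
qed

text \<open>Hypothesis \<open>fin\<close> gives \<open>L\<close> finite index, so every diagonal
  entry of its Hermite normal form is positive. Elimination from the highest coordinate downwards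
  shows that the rows generate \<open>L\<close>.\<close>

lemma param_collection_exists:
  assumes L: "subgroup L (free_Abelian_group {1..<r})"
    and fin: "\<And>k. k \<in> {1..<r} \<Longrightarrow> \<exists>c>0. frag_cmul c (frag_of k) \<in> L"
  shows "\<exists>m. param_collection r m \<and> param_subgroup r m = L"
proof -
  have "\<exists>w. w \<in> L \<and> Poly_Mapping.keys w \<subseteq> {1..k} \<and> poly_mapping.lookup w k > 0 \<and>
      (\<forall>v\<in>L. Poly_Mapping.keys v \<subseteq> {1..k} \<longrightarrow> poly_mapping.lookup w k dvd poly_mapping.lookup v k)"
    if "k \<in> {1..<r}" for k
    using fin[OF that] hermite_leading_coefficient[OF L, of _ k] that
    by (metis atLeastLessThan_iff)
  then obtain w where w: "\<And>k. k \<in> {1..<r} \<Longrightarrow> w k \<in> L \<and> Poly_Mapping.keys (w k) \<subseteq> {1..k} \<and>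
      poly_mapping.lookup (w k) k > 0 \<and>
      (\<forall>v\<in>L. Poly_Mapping.keys v \<subseteq> {1..k} \<longrightarrow> poly_mapping.lookup (w k) k dvd poly_mapping.lookup v k)"
    by metis
  have "\<exists>v\<in>L. Poly_Mapping.keys v \<subseteq> {1..k} \<and> poly_mapping.lookup v k = poly_mapping.lookup (w k) k \<and>
    (\<forall>i\<in>{1..<k}. 0 \<le> poly_mapping.lookup v i \<and> poly_mapping.lookup v i < poly_mapping.lookup (w i) i)"
    if "k \<in> {1..<r}" for k
    \<comment> \<open>With \<open>t = k\<close> every index below \<open>k\<close> lies in the
      reduced range.\<close>
    using hermite_reduce[OF L that, of w k] w by auto
  then obtain v where v: "\<And>k. k \<in> {1..<r} \<Longrightarrow> v k \<in> L \<and> Poly_Mapping.keys (v k) \<subseteq> {1..k} \<and>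
      poly_mapping.lookup (v k) k = poly_mapping.lookup (w k) k \<and>
      (\<forall>i\<in>{1..<k}. 0 \<le> poly_mapping.lookup (v k) i \<and> poly_mapping.lookup (v k) i < poly_mapping.lookup (w i) i)"
    by metis
  define m where "m = (\<lambda>k. poly_mapping.lookup (v k))"
  \<comment> \<open>The entries of \<open>v k\<close> were reduced modulo the diagonal of
    \<open>w\<close>, and the diagonals of \<open>v\<close> and \<open>w\<close> agree.\<close>
  have "param_collection r m"
    using v w unfolding param_collection_def m_def
    by (smt (verit) atLeastLessThan_iff int_one_le_iff_zero_less)
  moreover have rel: "param_relators r m = v ` {1..<r}"
    unfolding param_relators_def m_def
    by (intro image_cong frag_expansion_atMost refl) (simp_all add: v del: One_nat_def)
  have gen: "subgroup (param_subgroup r m) (free_Abelian_group {1..<r})"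
    unfolding param_subgroup_def rel
    by (rule group.generate_is_subgroup[OF group_free_Abelian_group])
      (use v subgroup.subset[OF L] in auto)
  have "param_subgroup r m \<subseteq> L"
    unfolding param_subgroup_def rel
    by (rule group.generate_subgroup_incl[OF group_free_Abelian_group _ L]) (use v in auto)
  moreover have triangular: "u \<in> param_subgroup r m" if "u \<in> L" "Poly_Mapping.keys u \<subseteq> {1..k}" "k < r" for u k
    using that
  proof (induction k arbitrary: u)
    case 0
    then have "u = 0"
      by simp
    then show ?case
      using subgroup_free_Abelian_group(1)[OF gen] by simp
  next
    case (Suc k)
    have k: "Suc k \<in> {1..<r}"
      using Suc.prems by simp
    \<comment> \<open>The division is exact, because the leading coefficient of
      \<open>w (Suc k)\<close> divides that of every element of \<open>L\<close> supported on
      \<open>{1..Suc k}\<close>. Subtracting \<open>q\<close> times the row shrinks the support to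
      \<open>{1..k}\<close>.\<close>
    define q where "q = poly_mapping.lookup u (Suc k) div poly_mapping.lookup (w (Suc k)) (Suc k)"
    have q: "poly_mapping.lookup u (Suc k) = q * poly_mapping.lookup (w (Suc k)) (Suc k)"
      using w[OF k] Suc.prems by (simp add: q_def)
    have vk: "frag_cmul q (v (Suc k)) \<in> param_subgroup r m"
      by (rule subgroup_free_Abelian_group(4)[OF gen])
        (use k in \<open>auto simp: param_subgroup_def rel intro: generate.incl\<close>)
    have "poly_mapping.lookup (u - frag_cmul q (v (Suc k))) (Suc k) = 0"
      using q v[OF k] by (simp add: lookup_minus)
    moreover have "Poly_Mapping.keys (u - frag_cmul q (v (Suc k))) \<subseteq> {1..Suc k}"
      using v[OF k] Suc.prems keys_diff[of u] keys_cmul by fastforce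
    ultimately have "Poly_Mapping.keys (u - frag_cmul q (v (Suc k))) \<subseteq> {1..k}"
      by (auto simp: in_keys_iff le_Suc_eq subset_iff)
    then have "u - frag_cmul q (v (Suc k)) \<in> param_subgroup r m"
      using Suc v[OF k] subgroup_free_Abelian_group(3,4)[OF L] by simp
    then show ?case
      using subgroup_free_Abelian_group(2)[OF gen _ vk] by fastforce
  qed
  have "L \<subseteq> param_subgroup r m"
  proof
    fix u assume u: "u \<in> L"
    then have keys: "Poly_Mapping.keys u \<subseteq> {1..<r}"
      using subgroup.subset[OF L] by (metis carrier_free_Abelian_group_iff subsetD)
    show "u \<in> param_subgroup r m"
    proof (cases r)
      case 0
      then show ?thesis
        using keys subgroup_free_Abelian_group(1)[OF gen] by simp
    next
      case (Suc k)
      then show ?thesis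
        using triangular[OF u, of k] keys by (simp add: atLeastLessThanSuc_atLeastAtMost)
    qed
  qed
  ultimately show ?thesis
    by blast
qed

section \<open>Existence of parameters\<close>

lemma mod_diff_less: "0 < r \<Longrightarrow> mod_diff r j i < r"
  by (simp add: mod_diff_def nat_less_iff)

lemma mod_diff_self [simp]: "mod_diff r i i = 0"
  by (simp add: mod_diff_def)

lemma mod_diff_inj:
  assumes "j \<in> {1..r}" "j' \<in> {1..r}" "mod_diff r j i = mod_diff r j' i"
  shows "j = j'"
proof -
  have r: "int r > 0"
    using assms(1) by simp
  have "(int j - int i) mod int r = (int j' - int i) mod int r"
    using assms(3) r by (simp add: mod_diff_def eq_nat_nat_iff)
  then have "int r dvd (int j - int i) - (int j' - int i)"
    by (rule mod_eq_dvd_iff[THEN iffD1])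
  then have "int r dvd int j - int j'"
    by simp
  moreover have "\<bar>int j - int j'\<bar> < int r"
    using assms by auto
  ultimately show ?thesis
    using zdvd_imp_le[of "int r" "\<bar>int j - int j'\<bar>"] by fastforce
qed

lemma mod_diff_eq_0_iff: "i \<in> {1..r} \<Longrightarrow> j \<in> {1..r} \<Longrightarrow> mod_diff r j i = 0 \<longleftrightarrow> j = i"
  using mod_diff_inj[of j r i i] by auto

lemma mod_diff_surj:
  assumes "k < r"
  shows "\<exists>j\<in>{1..r}. mod_diff r j i = k"
proof
  \<comment> \<open>This is i + k modulo r; subtracting 1 before the reduction and adding it
    afterwards yields representatives 1..r instead of 0..r-1.\<close>
  define j where "j = nat ((int i + int k - 1) mod int r) + 1"
  have "(int i + int k - 1) mod int r < int r" "0 \<le> (int i + int k - 1) mod int r"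
    using assms by simp_all
  then show "j \<in> {1..r}"
    by (auto simp: j_def)
  have "int j - int i = (int i + int k - 1) mod int r - (int i - 1)"
    using assms by (simp add: j_def)
  then have "(int j - int i) mod int r = ((int i + int k - 1) mod int r - (int i - 1)) mod int r"
    by (rule arg_cong)
  also have "\<dots> = (int i + int k - 1 - (int i - 1)) mod int r"
    by (rule mod_diff_left_eq)
  finally show "mod_diff r j i = k"
    using assms by (simp add: mod_diff_def)
qed

text \<open>A transporter is naturally a left coset of the stabiliser. Commutativity makes it a
  right coset, which is the form of the elements of a \<open>Mod\<close> quotient.\<close>

lemma (in group_action) transporter_eq_coset:
  assumes "comm_group G" "x \<in> E" "c \<in> carrier G"
  shows "{d \<in> carrier G. \<phi> d x = \<phi> c x} = stabilizer G \<phi> x #> c"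
proof -
  interpret G: comm_group G
    by fact
  have "d \<in> stabilizer G \<phi> x #> c" if d: "d \<in> carrier G" "\<phi> d x = \<phi> c x" for d
  proof -
    have "\<phi> (inv c \<otimes> d) x = \<phi> (inv c) (\<phi> c x)"
      using assms d by (simp add: composition_rule)
    also have "\<dots> = x"
      using assms orbit_sym_aux by blast
    finally have "inv c \<otimes> d \<in> stabilizer G \<phi> x"
      using assms d by (simp add: stabilizer_def)
    moreover have "d = (inv c \<otimes> d) \<otimes> c"
      using assms d G.m_comm[of "inv c \<otimes> d" c] by (simp flip: G.m_assoc)
    ultimately show ?thesis
      unfolding r_coset_def by blast
  qed
  moreover have "h \<otimes> c \<in> carrier G \<and> \<phi> (h \<otimes> c) x = \<phi> c x" if "h \<in> stabilizer G \<phi> x" for h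
  proof -
    have h: "h \<in> carrier G" "\<phi> h x = x"
      using that by (simp_all add: stabilizer_def)
    then have "\<phi> (c \<otimes> h) x = \<phi> c x"
      using assms by (simp add: composition_rule)
    then show ?thesis
      using h assms by (simp add: G.m_comm)
  qed
  ultimately show ?thesis
    unfolding r_coset_def by blast
qed

section \<open>The commutative group of translations\<close>

context abelian_quandle
begin

abbreviation "TG \<equiv> translation_group Q tri"

definition translation :: "'a \<Rightarrow> 'a \<Rightarrow> 'a" where
  "translation b = (\<lambda>a\<in>Q. tri a b)"

lemma translation_apply: "a \<in> Q \<Longrightarrow> translation b a = tri a b"
  by (simp add: translation_def)

lemma carrier_TG: "carrier TG = generate (BijGroup Q) (translation ` Q)"
  by (simp add: translation_group_def translation_def[abs_def])

lemma translation_Bij: "b \<in> Q \<Longrightarrow> translation b \<in> Bij Q"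
  using bij_translation[of b] by (auto simp: Bij_def translation_def cong: bij_betw_cong)

lemma translation_subset: "translation ` Q \<subseteq> carrier (BijGroup Q)"
  using translation_Bij by (auto simp: BijGroup_def)

lemma subgroup_TG: "subgroup (carrier TG) (BijGroup Q)"
  unfolding carrier_TG by (rule group.generate_is_subgroup[OF group_BijGroup translation_subset])

lemma TG_eq: "TG = BijGroup Q\<lparr>carrier := carrier TG\<rparr>"
  by (simp add: translation_group_def)

lemma group_TG: "group TG"
  using group.subgroup_imp_group[OF group_BijGroup subgroup_TG] TG_eq by simp

lemma generate_TG: "generate TG (translation ` Q) = carrier TG"
proof -
  have "translation ` Q \<subseteq> carrier TG"
    unfolding carrier_TG by (auto intro: generate.incl)
  then show ?thesis
    using group.generate_consistent[OF group_BijGroup _ subgroup_TG] TG_eq carrier_TG by metis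
qed

lemma translation_TG: "b \<in> Q \<Longrightarrow> translation b \<in> carrier TG"
  unfolding carrier_TG by (auto intro: generate.incl)

lemma TG_action: "group_action TG Q (\<lambda>g. g)"
proof -
  have "(\<lambda>g. g) \<in> hom TG (BijGroup Q)"
    using subgroup.subset[OF subgroup_TG] by (auto simp: hom_def translation_group_def)
  then show ?thesis
    unfolding group_action_def group_hom_def group_hom_axioms_def
    using group_TG group_BijGroup by blast
qed

interpretation TG: group_action TG Q "\<lambda>g. g"
  by (rule TG_action)

lemma comm_group_TG: "comm_group TG"
proof (rule group.comm_group_generators[OF group_TG _ generate_TG])
  show "translation ` Q \<subseteq> carrier TG"
    using translation_TG by blast
  fix f g assume "f \<in> translation ` Q" "g \<in> translation ` Q"
  then obtain b c where bc: "b \<in> Q" "f = translation b" "c \<in> Q" "g = translation c"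
    by blast
  then have "compose Q f g = compose Q g f"
    using closed abelian by (auto simp: compose_def translation_def fun_eq_iff)
  then show "f \<otimes>\<^bsub>TG\<^esub> g = g \<otimes>\<^bsub>TG\<^esub> f"
    using bc translation_Bij by (simp add: translation_group_def BijGroup_def)
qed

text \<open>Translation by \<open>c\<close> is onto, so \<open>a\<close> is some
  \<open>tri x c\<close>. Self-distributivity then pulls the translation by \<open>c\<close>
  outside, and the abelian law moves it back onto \<open>x\<close>.\<close>

lemma tri_translate_right:
  assumes "a \<in> Q" "b \<in> Q" "c \<in> Q"
  shows "tri a (tri b c) = tri a b"
proof -
  obtain x where x: "x \<in> Q" "a = tri x c"
    using bij_translation[OF assms(3)] assms(1) by (auto simp: bij_betw_def)
  then have "tri a (tri b c) = tri (tri x b) c"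
    using self_distrib assms by simp
  also have "\<dots> = tri a b"
    using abelian assms x by simp
  finally show ?thesis .
qed

lemma tri_TG_right:
  assumes "T \<in> carrier TG" "a \<in> Q" "b \<in> Q"
  shows "tri a (T b) = tri a b"
proof -
  have "T \<in> generate TG (translation ` Q)"
    using assms generate_TG by simp
  then show ?thesis
    using assms(3)
  proof (induction T arbitrary: b rule: generate.induct)
    case one
    then show ?case
      by (simp flip: TG.id_eq_one)
  next
    case (incl h)
    then show ?case
      using assms(2) by (auto simp: translation_apply tri_translate_right)
  next
    case (inv h)
    then obtain c where c: "c \<in> Q" "h = translation c"
      by blast
    have hT: "inv\<^bsub>TG\<^esub> h \<in> carrier TG"
      using c translation_TG group.inv_closed[OF group_TG] by simp
    \<comment> \<open>The preimage of \<open>b\<close> under \<open>h\<close> is the point to which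
      \<open>tri_translate_right\<close> applies, since \<open>b\<close> is its translate by
      \<open>c\<close>.\<close>
    then have y: "(inv\<^bsub>TG\<^esub> h) b \<in> Q"
      using TG.element_image inv by blast
    have "h ((inv\<^bsub>TG\<^esub> h) b) = b"
      using TG.orbit_sym_aux[OF hT inv(2) HOL.refl] c translation_TG
      by (simp add: group.inv_inv[OF group_TG])
    then show ?case
      using tri_translate_right[OF assms(2) y c(1)] c y by (simp add: translation_apply)
  next
    case (eng h1 h2)
    have "h1 \<in> carrier TG" "h2 \<in> carrier TG"
      using eng generate_TG by auto
    then show ?case
      using TG.composition_rule[OF eng.prems] eng TG.element_image by metis
  qed
qed

end

section \<open>Orbits and their coordinates\<close>

locale abelian_quandle_ordered_orbits = abelian_quandle +
  fixes r :: nat and orb :: "nat \<Rightarrow> 'a set"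
  assumes finite_Q: "finite Q" and orb: "bij_betw orb {1..r} (quandle_orbits Q tri)"
begin

interpretation TG: group_action TG Q "\<lambda>g. g"
  by (rule TG_action)

lemma orb_eq_orbit:
  assumes "i \<in> {1..r}" "x \<in> orb i"
  shows "x \<in> Q" "orb i = orbit TG (\<lambda>g. g) x"
proof -
  have "orb i \<in> quandle_orbits Q tri"
    using orb assms by (auto simp: bij_betw_def)
  then obtain y where y: "y \<in> Q" "orb i = orbit TG (\<lambda>g. g) y"
    by (auto simp: quandle_orbits_def orbits_def)
  then obtain T where T: "T \<in> carrier TG" "x = T y"
    using assms by (auto simp: orbit_def)
  show x: "x \<in> Q"
    using T y TG.element_image by blast
  have xy: "x \<in> orbit TG (\<lambda>g. g) y" and yx: "y \<in> orbit TG (\<lambda>g. g) x"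
    using assms(2) y TG.orbit_sym[OF y(1) x] by simp_all
  have mem: "z \<in> Q" if "w \<in> Q" "z \<in> orbit TG (\<lambda>g. g) w" for w z
    using that TG.element_image by (auto simp: orbit_def)
  show "orb i = orbit TG (\<lambda>g. g) x"
    unfolding y(2) using TG.orbit_trans[OF x y(1) _ yx] TG.orbit_trans[OF y(1) x _ xy] mem x y(1)
    by blast
qed

lemma orb_nonempty:
  assumes "i \<in> {1..r}"
  shows "orb i \<noteq> {}"
proof -
  have "orb i \<in> quandle_orbits Q tri"
    using orb assms by (auto simp: bij_betw_def)
  then show ?thesis
    using TG.orbit_refl by (force simp: quandle_orbits_def orbits_def)
qed

lemma ex_orb:
  assumes "x \<in> Q"
  obtains i where "i \<in> {1..r}" "x \<in> orb i"
proof -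
  have "orbit TG (\<lambda>g. g) x \<in> orb ` {1..r}"
    using orb assms by (auto simp: bij_betw_def quandle_orbits_def orbits_def)
  then show thesis
    using that TG.orbit_refl[OF assms] by force
qed

lemma orb_unique:
  assumes "i \<in> {1..r}" "j \<in> {1..r}" "x \<in> orb i" "x \<in> orb j"
  shows "i = j"
proof -
  have "orb i = orb j"
    using orb_eq_orbit assms by metis
  then show ?thesis
    using bij_betw_imp_inj_on[OF orb] assms(1,2) by (simp add: inj_on_eq_iff)
qed

lemma orb_TG_closed:
  assumes "i \<in> {1..r}" "x \<in> orb i" "T \<in> carrier TG"
  shows "T x \<in> orb i"
  using orb_eq_orbit(2)[OF assms(1,2)] assms(3) by (auto simp: orbit_def)

lemma orb_tri_closed: "i \<in> {1..r} \<Longrightarrow> x \<in> orb i \<Longrightarrow> b \<in> Q \<Longrightarrow> tri x b \<in> orb i"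
  using orb_TG_closed[of i x "translation b"] translation_TG orb_eq_orbit(1)
  by (simp add: translation_apply)

lemma tri_eq_of_orb:
  assumes "j \<in> {1..r}" "b \<in> orb j" "b' \<in> orb j" "a \<in> Q"
  shows "tri a b = tri a b'"
proof -
  obtain T where "T \<in> carrier TG" "b = T b'"
    using orb_eq_orbit(2)[OF assms(1,3)] assms(2) by (auto simp: orbit_def)
  then show ?thesis
    using tri_TG_right assms orb_eq_orbit(1) by metis
qed

text \<open>Inside an orbit \<open>b\<close> may be exchanged for \<open>a\<close> itself, and
  idempotence applies. This is why the parameters put x_0 = 1.\<close>

lemma tri_own_orb: "i \<in> {1..r} \<Longrightarrow> a \<in> orb i \<Longrightarrow> b \<in> orb i \<Longrightarrow> tri a b = a"
  using tri_eq_of_orb[of i b a a] idem orb_eq_orbit(1) by metis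

text \<open>The coordinate of a point of an orbit is the set of all elements of the free abelian group that
  carry a fixed base point to it; this is a coset of the stabiliser.\<close>

lemma orbit_coordinates:
  assumes i: "i \<in> {1..r}"
  shows "\<exists>m h. param_collection r m \<and> bij_betw h (orb i) (carrier (GM r m)) \<and>
    (\<forall>j\<in>{1..r}. \<forall>x\<in>orb i. \<forall>b\<in>orb j.
      h (tri x b) = h x \<otimes>\<^bsub>GM r m\<^esub> GM_gen r m (mod_diff r j i))"
proof -
  let ?F = "free_Abelian_group {1..<r}"
  have r: "0 < r"
    using i by simp
  interpret F: comm_group ?F
    by (rule abelian_free_Abelian_group)
  interpret T: comm_group TG
    by (rule comm_group_TG)
  obtain a where a: "a \<in> orb i"
    using orb_nonempty[OF i] by blast
  have aQ: "a \<in> Q"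
    using orb_eq_orbit(1)[OF i a] .
  have "\<forall>k. \<exists>j. k \<in> {1..<r} \<longrightarrow> j \<in> {1..r} \<and> mod_diff r j i = k"
    using mod_diff_surj by fastforce
  \<comment> \<open>\<open>\<sigma> k\<close> is the orbit with index i + k modulo r, whose
    translation is to be the action of the \<open>k\<close>-th free generator.\<close>
  then obtain \<sigma> where \<sigma>: "\<And>k. k \<in> {1..<r} \<Longrightarrow> \<sigma> k \<in> {1..r} \<and> mod_diff r (\<sigma> k) i = k"
    by metis
  have "\<forall>j. \<exists>b. j \<in> {1..r} \<longrightarrow> b \<in> orb j"
    using orb_nonempty by blast
  then obtain base where base: "\<And>j. j \<in> {1..r} \<Longrightarrow> base j \<in> orb j"
    by metis
  obtain A where A: "A \<in> hom ?F TG"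
    and A_gen: "\<And>k. k \<in> {1..<r} \<Longrightarrow> A (frag_of k) = translation (base (\<sigma> k))"
    by (rule T.free_Abelian_group_universal[of "\<lambda>k. translation (base (\<sigma> k))" "{1..<r}"])
      (use \<sigma> base orb_eq_orbit(1) translation_TG in blast)+
  have A_hom: "group_hom ?F TG A"
    using A by unfold_locales
  then interpret A: group_hom ?F TG A .
  have act: "group_action ?F Q A"
  proof -
    have "A \<in> hom ?F (BijGroup Q)"
      using hom_compose[OF A, of "\<lambda>g. g" "BijGroup Q"] TG.group_hom
      by (simp add: group_hom_def group_hom_axioms_def o_def)
    then show ?thesis
      unfolding group_action_def group_hom_def group_hom_axioms_def
      using group_BijGroup by auto
  qed
  then interpret act: group_action ?F Q A .
  have A_tri: "A (frag_of (mod_diff r j i)) x = tri x b"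
    if "j \<in> {1..r}" "j \<noteq> i" "b \<in> orb j" "x \<in> Q" for j b x
  proof -
    have k: "mod_diff r j i \<in> {1..<r}"
      using that i mod_diff_less[OF r] mod_diff_eq_0_iff[OF i that(1)] by (auto simp: Suc_le_eq)
    then have "\<sigma> (mod_diff r j i) = j"
      using \<sigma> that mod_diff_inj by metis
    then show ?thesis
      using k tri_eq_of_orb[OF that(1) base[OF that(1)] that(3,4)] that(4)
      by (simp add: A_gen translation_apply)
  qed
  \<comment> \<open>Agreement can be expected on \<open>orb i\<close> only. Translations by elements
    of \<open>orb i\<close> are trivial there but may move other orbits, and \<open>A\<close> has no
    generator for them.\<close>
  have TG_A: "\<exists>c. c \<in> carrier ?F \<and> (\<forall>x\<in>orb i. T x = A c x)" if "T \<in> carrier TG" for T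
  proof -
    let ?H = "{T \<in> carrier TG. \<exists>c. c \<in> carrier ?F \<and> (\<forall>x\<in>orb i. T x = A c x)}"
    have "subgroup ?H TG"
    proof (rule T.subgroupI)
      have "\<one>\<^bsub>TG\<^esub> \<in> ?H"
        using A.hom_one by (intro CollectI conjI T.one_closed exI[of _ 0]) simp_all
      then show "?H \<noteq> {}"
        by blast
    next
      fix T assume "T \<in> ?H"
      then obtain c where T: "T \<in> carrier TG" and c: "c \<in> carrier ?F" "\<And>x. x \<in> orb i \<Longrightarrow> T x = A c x"
        by blast
      have "(inv\<^bsub>TG\<^esub> T) x = A (inv\<^bsub>?F\<^esub> c) x" if x: "x \<in> orb i" for x
      proof -
        let ?y = "(inv\<^bsub>TG\<^esub> T) x"
        have y: "?y \<in> orb i"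
          by (rule orb_TG_closed[OF i x T.inv_closed[OF T]])
        have "T ?y = x"
          using TG.orbit_sym_aux[OF T.inv_closed[OF T] orb_eq_orbit(1)[OF i x] HOL.refl] T by simp
        then have "A c ?y = x"
          using c(2)[OF y] by simp
        then show ?thesis
          using act.orbit_sym_aux[OF c(1) orb_eq_orbit(1)[OF i y]] by simp
      qed
      then show "inv\<^bsub>TG\<^esub> T \<in> ?H"
        using T F.inv_closed[OF c(1)] by blast
    next
      fix T1 T2 assume "T1 \<in> ?H" "T2 \<in> ?H"
      then obtain c1 c2 where h: "T1 \<in> carrier TG" "T2 \<in> carrier TG"
        and c: "c1 \<in> carrier ?F" "\<And>x. x \<in> orb i \<Longrightarrow> T1 x = A c1 x"
        "c2 \<in> carrier ?F" "\<And>x. x \<in> orb i \<Longrightarrow> T2 x = A c2 x"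
        by blast
      have "(T1 \<otimes>\<^bsub>TG\<^esub> T2) x = A (c1 \<otimes>\<^bsub>?F\<^esub> c2) x" if "x \<in> orb i" for x
        using TG.composition_rule[OF orb_eq_orbit(1)[OF i that] h] c orb_TG_closed[OF i that h(2)] that
          act.composition_rule[OF orb_eq_orbit(1)[OF i that] c(1,3)] by metis
      then show "T1 \<otimes>\<^bsub>TG\<^esub> T2 \<in> ?H"
        using F.m_closed[OF c(1,3)] T.m_closed[OF h] by blast
    qed auto
    moreover have "translation b \<in> ?H" if b: "b \<in> Q" for b
    proof -
      obtain j where j: "j \<in> {1..r}" "b \<in> orb j"
        using ex_orb[OF b(1)] .
      have "\<exists>c. c \<in> carrier ?F \<and> (\<forall>x\<in>orb i. translation b x = A c x)"
      proof (cases "j = i")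
        case True
        have "translation b x = A 0 x" if x: "x \<in> orb i" for x
          using fun_cong[OF act.id_eq_one, of x] j True tri_own_orb[OF i x] orb_eq_orbit(1)[OF i x]
          by (simp add: translation_apply)
        then show ?thesis
          by (intro exI[of _ 0]) simp
      next
        case False
        then have "frag_of (mod_diff r j i) \<in> carrier ?F"
          using i j mod_diff_less[OF r] mod_diff_eq_0_iff[OF i j(1)] by (auto simp: Suc_le_eq)
        moreover have "translation b x = A (frag_of (mod_diff r j i)) x" if "x \<in> orb i" for x
          using A_tri[OF j(1) False j(2)] orb_eq_orbit(1)[OF i that] by (simp add: translation_apply)
        ultimately show ?thesis
          by blast
      qed
      then show ?thesis
        using translation_TG[OF b] by blast
    qed
    ultimately have "generate TG (translation ` Q) \<subseteq> ?H"
      by (intro T.generate_subgroup_incl) blast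
    then show ?thesis
      using that generate_TG by blast
  qed
  define L where "L = stabilizer ?F A a"
  have L: "subgroup L ?F"
    unfolding L_def by (rule act.stabilizer_subgroup[OF aQ])
  have "\<exists>c>0. frag_cmul c (frag_of k) \<in> L" if k: "k \<in> {1..<r}" for k
  proof -
    let ?e = "\<lambda>n::nat. frag_cmul (int n) (frag_of k)"
    have e: "?e n \<in> carrier ?F" for n
      using k keys_cmul[of "int n" "frag_of k"] by auto
    \<comment> \<open>Pigeonhole: two multiples of the \<open>k\<close>-th basis vector move
      \<open>a\<close> to the same point, and their difference lies in the stabiliser.\<close>
    have "range (\<lambda>n. A (?e n) a) \<subseteq> Q"
      using act.element_image[OF e aQ] by blast
    then have "\<not> inj (\<lambda>n. A (?e n) a)"
      using finite_Q finite_subset finite_imageD infinite_UNIV_nat by metis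
    then obtain n n' where n: "A (?e n) a = A (?e n') a" "n < n'"
      unfolding inj_def by (metis linorder_neqE_nat)
    then have "?e n' \<in> L #>\<^bsub>?F\<^esub> ?e n"
      using act.transporter_eq_coset[OF F.comm_group_axioms aQ e, of n] e unfolding L_def by fastforce
    then obtain u where "u \<in> L" "?e n' = u + ?e n"
      by (auto simp: r_coset_def)
    then have "frag_cmul (int n' - int n) (frag_of k) \<in> L"
      by (simp add: frag_cmul_diff_distrib)
    then show ?thesis
      using n(2) by (intro exI[of _ "int n' - int n"]) auto
  qed
  then obtain m where m: "param_collection r m" "param_subgroup r m = L"
    using param_collection_exists[OF L] by blast
  have GM: "GM r m = ?F Mod L"
    by (simp add: GM_def m)
  interpret L: normal L ?F
    using L by (simp only: F.normal_iff_subgroup)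
  interpret FL: group "?F Mod L"
    by (rule L.factorgroup_is_group)
  define h where "h x = {c \<in> carrier ?F. A c a = x}" for x
  have h_A: "h (A c a) = L #>\<^bsub>?F\<^esub> c" if "c \<in> carrier ?F" for c
    unfolding h_def L_def by (rule act.transporter_eq_coset[OF F.comm_group_axioms aQ that])
  have orb_A: "orb i = (\<lambda>c. A c a) ` carrier ?F"
  proof
    show "orb i \<subseteq> (\<lambda>c. A c a) ` carrier ?F"
    proof
      fix x assume "x \<in> orb i"
      then obtain T where T: "T \<in> carrier TG" "x = T a"
        using orb_eq_orbit(2)[OF i a] by (auto simp: orbit_def)
      obtain c where "c \<in> carrier ?F" "\<And>x. x \<in> orb i \<Longrightarrow> T x = A c x"
        using TG_A[OF T(1)] by blast
      then show "x \<in> (\<lambda>c. A c a) ` carrier ?F"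
        using T(2) a by blast
    qed
    show "(\<lambda>c. A c a) ` carrier ?F \<subseteq> orb i"
      using orb_TG_closed[OF i a] A.hom_closed by blast
  qed
  have "h ` orb i = carrier (?F Mod L)"
    by (auto simp: orb_A image_image h_A carrier_FactGroup simp del: carrier_free_Abelian_group_iff)
  moreover have "inj_on h (orb i)"
  proof (rule inj_onI)
    fix x y assume xy: "x \<in> orb i" "h x = h y"
    obtain c where c: "c \<in> carrier ?F" "x = A c a"
      using xy(1) unfolding orb_A by blast
    then have "c \<in> h y"
      unfolding xy(2)[symmetric] by (simp add: h_def)
    then show "x = y"
      unfolding c(2) h_def by simp
  qed
  moreover have "h (tri x b) = h x \<otimes>\<^bsub>GM r m\<^esub> GM_gen r m (mod_diff r j i)"
    if jxb: "j \<in> {1..r}" "x \<in> orb i" "b \<in> orb j" for j x b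
  proof -
    obtain c where c: "c \<in> carrier ?F" "x = A c a"
      using jxb(2) unfolding orb_A by blast
    show ?thesis
    proof (cases "j = i")
      case True
      then show ?thesis
        using tri_own_orb[OF i jxb(2)] jxb c FL.r_one[of "L #>\<^bsub>?F\<^esub> c"]
        by (simp add: GM_gen_def GM h_A carrier_FactGroup del: carrier_free_Abelian_group_iff)
    next
      case False
      let ?k = "mod_diff r j i"
      have k: "?k \<noteq> 0" "?k < r"
        using False mod_diff_less[OF r] mod_diff_eq_0_iff[OF i jxb(1)] by simp_all
      then have e: "frag_of ?k \<in> carrier ?F"
        by simp
      have "tri x b = A (frag_of ?k \<otimes>\<^bsub>?F\<^esub> c) a"
        using act.composition_rule[OF aQ e c(1)] A_tri[OF jxb(1) False jxb(3)] c
          orb_eq_orbit(1)[OF i jxb(2)] by simp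
      also have "frag_of ?k \<otimes>\<^bsub>?F\<^esub> c = c \<otimes>\<^bsub>?F\<^esub> frag_of ?k"
        using e c by (intro F.m_comm)
      finally have "h (tri x b) = L #>\<^bsub>?F\<^esub> (c \<otimes>\<^bsub>?F\<^esub> frag_of ?k)"
        by (simp only: h_A[OF F.m_closed[OF c(1) e]])
      also have "\<dots> = (L #>\<^bsub>?F\<^esub> c) <#>\<^bsub>?F\<^esub> (L #>\<^bsub>?F\<^esub> frag_of ?k)"
        by (rule L.rcos_sum[OF c(1) e, symmetric])
      finally show ?thesis
        using k h_A[OF c(1)] c(2) by (simp add: GM GM_gen_def m)
    qed
  qed
  ultimately show ?thesis
    using m GM by (intro exI[of _ m] exI[of _ h]) (auto simp: bij_betw_def)
qed

text \<open>Coordinates may be chosen on each orbit separately. In \<open>Q_op\<close> the right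
  argument enters only through its orbit index, so the choices glue without any compatibility
  condition.\<close>

lemma ex_parameters: "\<exists>M. is_parameters Q tri r orb M"
proof -
  define P where "P i m h \<longleftrightarrow> param_collection r m \<and> bij_betw h (orb i) (carrier (GM r m)) \<and>
    (\<forall>j\<in>{1..r}. \<forall>x\<in>orb i. \<forall>b\<in>orb j.
      h (tri x b) = h x \<otimes>\<^bsub>GM r m\<^esub> GM_gen r m (mod_diff r j i))" for i m h
  have "\<exists>m h. P i m h" if "i \<in> {1..r}" for i
    unfolding P_def by (rule orbit_coordinates[OF that])
  then obtain M h where P: "\<And>i. i \<in> {1..r} \<Longrightarrow> P i (M i) (h i)"
    by metis
  note Mh = P[unfolded P_def]
  have "\<forall>x. \<exists>i. x \<in> Q \<longrightarrow> i \<in> {1..r} \<and> x \<in> orb i"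
    using ex_orb by blast
  then obtain ind where ind: "\<And>x. x \<in> Q \<Longrightarrow> ind x \<in> {1..r} \<and> x \<in> orb (ind x)"
    by metis
  have ind_eq: "ind x = i" if "i \<in> {1..r}" "x \<in> orb i" for i x
    using that ind orb_unique orb_eq_orbit(1) by metis
  define f where "f x = (ind x, h (ind x) x)" for x
  have f_orb: "f ` orb i = {i} \<times> carrier (GM r (M i))" if "i \<in> {1..r}" for i
  proof -
    have "f ` orb i = Pair i ` h i ` orb i"
      using that by (auto simp: f_def ind_eq image_image)
    then show ?thesis
      using Mh[OF that] by (auto simp: bij_betw_def)
  qed
  have Q: "Q = (\<Union>i\<in>{1..r}. orb i)"
    using ind orb_eq_orbit(1) by blast
  have "f ` Q = Q_carrier r M"
    unfolding Q image_UN Q_carrier_def using f_orb by auto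
  moreover have "inj_on f Q"
  proof (rule inj_onI)
    fix x y assume xy: "x \<in> Q" "y \<in> Q" "f x = f y"
    then have "ind x = ind y" "h (ind x) x = h (ind x) y"
      by (metis f_def prod.inject)+
    then show "x = y"
      using Mh[of "ind x"] ind[OF xy(1)] ind[OF xy(2)] by (auto simp: bij_betw_def inj_on_def)
  qed
  moreover have "f (tri x b) = Q_op r M (f x) (f b)" if "x \<in> Q" "b \<in> Q" for x b
  proof -
    have "ind (tri x b) = ind x"
      using ind[OF that(1)] orb_tri_closed that by (intro ind_eq) auto
    then show ?thesis
      using Mh ind[OF that(1)] ind[OF that(2)] by (simp add: f_def Q_op_def)
  qed
  ultimately have "f \<in> quandle_iso Q tri (Q_carrier r M) (Q_op r M)"
    by (simp add: quandle_iso_def bij_betw_def)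
  moreover have "\<forall>i\<in>{1..r}. param_collection r (M i)"
    using Mh by simp
  moreover have "\<forall>i\<in>{1..r}. f ` orb i = {i} \<times> carrier (GM r (M i))"
    using f_orb by (rule ballI)
  ultimately show ?thesis
    unfolding is_parameters_def by (intro exI conjI bexI)
qed

end

section \<open>The groups attached to parameter collections\<close>

lemma param_relators_subset: "param_relators r m \<subseteq> carrier (free_Abelian_group {1..<r})"
proof
  fix c assume "c \<in> param_relators r m"
  then obtain i where i: "i \<in> {1..<r}" "c = (\<Sum>k = 1..i. frag_cmul (m i k) (frag_of k))"
    by (auto simp: param_relators_def)
  have "frag_cmul (m i k) (frag_of k) \<in> carrier (free_Abelian_group {1..<r})" if "k \<in> {1..i}" for k
    using that i(1) keys_cmul[of "m i k" "frag_of k"] by auto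
  then show "c \<in> carrier (free_Abelian_group {1..<r})"
    unfolding i(2) by (rule sum_closed_free_Abelian_group)
qed

lemma subgroup_param_subgroup: "subgroup (param_subgroup r m) (free_Abelian_group {1..<r})"
  unfolding param_subgroup_def
  by (rule group.generate_is_subgroup[OF group_free_Abelian_group param_relators_subset])

lemma comm_group_GM: "comm_group (GM r m)"
  unfolding GM_def
  by (rule comm_group.abelian_FactGroup[OF abelian_free_Abelian_group subgroup_param_subgroup])

lemma GM_coset_hom:
  "group_hom (free_Abelian_group {1..<r}) (GM r m)
    (\<lambda>c. param_subgroup r m #>\<^bsub>free_Abelian_group {1..<r}\<^esub> c)"
proof -
  have "param_subgroup r m \<lhd> free_Abelian_group {1..<r}"
    using subgroup_param_subgroup comm_group.normal_iff_subgroup[OF abelian_free_Abelian_group] by blast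
  then show ?thesis
    unfolding group_hom_def group_hom_axioms_def GM_def
    using normal.r_coset_hom_Mod normal.factorgroup_is_group group_free_Abelian_group by blast
qed

lemma GM_gen_closed:
  assumes "k < r"
  shows "GM_gen r m k \<in> carrier (GM r m)"
proof (cases "k = 0")
  case True
  then show ?thesis
    using comm_groupE(2)[OF comm_group_GM[of r m]] by (simp add: GM_gen_def)
next
  case False
  then have "frag_of k \<in> carrier (free_Abelian_group {1..<r})"
    using assms by simp
  then show ?thesis
    using False by (auto simp: GM_gen_def GM_def carrier_FactGroup)
qed

lemma generate_frag_of:
  "generate (free_Abelian_group S) (frag_of ` S) = carrier (free_Abelian_group S)"
proof
  have sub: "frag_of ` S \<subseteq> carrier (free_Abelian_group S)"
    by (auto simp del: carrier_free_Abelian_group_iff)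
  then show "generate (free_Abelian_group S) (frag_of ` S) \<subseteq> carrier (free_Abelian_group S)"
    by (rule group.generate_incl[OF group_free_Abelian_group])
  have gen: "subgroup (generate (free_Abelian_group S) (frag_of ` S)) (free_Abelian_group S)"
    by (rule group.generate_is_subgroup[OF group_free_Abelian_group sub])
  show "carrier (free_Abelian_group S) \<subseteq> generate (free_Abelian_group S) (frag_of ` S)"
  proof
    fix c assume "c \<in> carrier (free_Abelian_group S)"
    then have "Poly_Mapping.keys c \<subseteq> S"
      by simp
    then show "c \<in> generate (free_Abelian_group S) (frag_of ` S)"
      by (rule free_Abelian_group_induct)
        (use subgroup_free_Abelian_group[OF gen] in \<open>auto intro: generate.incl\<close>)
  qed
qed

lemma generate_GM_gen: "generate (GM r m) (GM_gen r m ` {1..<r}) = carrier (GM r m)"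
proof -
  let ?F = "free_Abelian_group {1..<r}"
  interpret q: group_hom ?F "GM r m" "\<lambda>c. param_subgroup r m #>\<^bsub>?F\<^esub> c"
    by (rule GM_coset_hom)
  have sub: "frag_of ` {1..<r} \<subseteq> carrier ?F"
    by (auto simp del: carrier_free_Abelian_group_iff)
  have "GM_gen r m ` {1..<r} = (\<lambda>c. param_subgroup r m #>\<^bsub>?F\<^esub> c) ` frag_of ` {1..<r}"
    by (force simp: GM_gen_def image_image)
  then show ?thesis
    using q.generate_img[OF sub] generate_frag_of[of "{1..<r}"]
    by (simp add: GM_def carrier_FactGroup)
qed

section \<open>Commutators in the structure group\<close>

definition structure_rels :: "'a set \<Rightarrow> ('a \<Rightarrow> 'a \<Rightarrow> 'a) \<Rightarrow> ('a word \<times> 'a word) set" where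
  "structure_rels Q tri =
    {([(a, True), (b, True)], [(b, True), (tri a b, True)]) | a b. a \<in> Q \<and> b \<in> Q}"

lemma structure_group_eq: "structure_group Q tri = presented_group Q (structure_rels Q tri)"
  by (simp add: structure_group_def structure_rels_def)

section \<open>The structure group in orbit coordinates\<close>

locale parametrized_quandle =
  fixes Q :: "'a set" and tri :: "'a \<Rightarrow> 'a \<Rightarrow> 'a" and r :: nat
    and M :: "nat \<Rightarrow> nat \<Rightarrow> nat \<Rightarrow> int" and f :: "'a \<Rightarrow> nat \<times> (nat \<Rightarrow>\<^sub>0 int) set"
  assumes tri_closed: "a \<in> Q \<Longrightarrow> b \<in> Q \<Longrightarrow> tri a b \<in> Q"
    and iso: "f \<in> quandle_iso Q tri (Q_carrier r M) (Q_op r M)"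
begin

abbreviation "I \<equiv> {1..r}"
abbreviation "K i \<equiv> GM r (M i)"
abbreviation "shift i j \<equiv> GM_gen r (M i) (mod_diff r j i)"

definition "SG = structure_group Q tri"

definition point :: "nat \<Rightarrow> (nat \<Rightarrow>\<^sub>0 int) set \<Rightarrow> 'a" where
  "point i s = inv_into Q f (i, s)"

definition gen :: "nat \<Rightarrow> (nat \<Rightarrow>\<^sub>0 int) set \<Rightarrow> 'a word set" where
  "gen i s = presented_gen Q (structure_rels Q tri) (point i s)"

sublocale K: comm_group "K i" for i
  by (rule comm_group_GM)

sublocale SG: group SG
  unfolding SG_def structure_group_eq by (rule group_presented_group)

lemma shift_closed: "i \<in> I \<Longrightarrow> shift i j \<in> carrier (K i)"
  by (intro GM_gen_closed mod_diff_less) simp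

lemma shift_self: "shift i i = \<one>\<^bsub>K i\<^esub>"
  by (simp add: GM_gen_def)

lemma generate_shift:
  assumes "i \<in> I"
  shows "generate (K i) (shift i ` I) = carrier (K i)"
proof
  have sub: "shift i ` I \<subseteq> carrier (K i)"
    using shift_closed assms by blast
  then show "generate (K i) (shift i ` I) \<subseteq> carrier (K i)"
    by (rule K.generate_incl)
  have "GM_gen r (M i) ` {1..<r} \<subseteq> shift i ` I"
    using mod_diff_surj[of _ r i] by fastforce
  then show "carrier (K i) \<subseteq> generate (K i) (shift i ` I)"
    using K.mono_generate[of _ _ i] by (simp flip: generate_GM_gen)
qed

lemma bij_f: "bij_betw f Q (SIGMA i:I. carrier (K i))"
  using iso by (simp add: quandle_iso_def Q_carrier_def)

lemma point:
  assumes "i \<in> I" "s \<in> carrier (K i)"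
  shows "point i s \<in> Q" "f (point i s) = (i, s)"
  using bij_f assms by (auto simp: point_def bij_betw_def inv_into_into f_inv_into_f)

lemma ex_point:
  assumes "a \<in> Q"
  obtains i s where "i \<in> I" "s \<in> carrier (K i)" "a = point i s"
proof -
  obtain i s where ind: "f a = (i, s)"
    by force
  then have "(i, s) \<in> (SIGMA i:I. carrier (K i))"
    using bij_f assms by (metis bij_betwE)
  moreover have "a = point i s"
    using bij_f assms by (simp add: point_def bij_betw_def flip: ind)
  ultimately show thesis
    using that by blast
qed

lemma tri_point:
  assumes "i \<in> I" "s \<in> carrier (K i)" "j \<in> I" "t \<in> carrier (K j)"
  shows "tri (point i s) (point j t) = point i (s \<otimes>\<^bsub>K i\<^esub> shift i j)"
proof -
  let ?a = "point i s" and ?b = "point j t"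
  have Q: "?a \<in> Q" "?b \<in> Q" "tri ?a ?b \<in> Q"
    using assms point tri_closed by simp_all
  have "f (tri ?a ?b) = (i, s \<otimes>\<^bsub>K i\<^esub> shift i j)"
    using iso Q assms point by (simp add: quandle_iso_def Q_op_def)
  then show ?thesis
    using bij_f Q by (metis bij_betw_def inv_into_f_f point_def)
qed

lemma gen_closed [simp]: "i \<in> I \<Longrightarrow> s \<in> carrier (K i) \<Longrightarrow> gen i s \<in> carrier SG"
  by (simp add: gen_def SG_def structure_group_eq presented_gen_closed point)

lemma generate_gen: "generate SG (\<Union>i\<in>I. gen i ` carrier (K i)) = carrier SG"
proof -
  have "(\<Union>i\<in>I. gen i ` carrier (K i)) = presented_gen Q (structure_rels Q tri) ` Q"
  proof
    show "(\<Union>i\<in>I. gen i ` carrier (K i)) \<subseteq> presented_gen Q (structure_rels Q tri) ` Q"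
      using point(1) unfolding gen_def by blast
    show "presented_gen Q (structure_rels Q tri) ` Q \<subseteq> (\<Union>i\<in>I. gen i ` carrier (K i))"
    proof (rule image_subsetI)
      fix a assume "a \<in> Q"
      then obtain i s where "i \<in> I" "s \<in> carrier (K i)" "a = point i s"
        by (rule ex_point)
      then show "presented_gen Q (structure_rels Q tri) a \<in> (\<Union>i\<in>I. gen i ` carrier (K i))"
        unfolding gen_def by blast
    qed
  qed
  then show ?thesis
    by (simp add: SG_def structure_group_eq generate_presented_gen)
qed

lemma gen_relation:
  assumes "i \<in> I" "s \<in> carrier (K i)" "j \<in> I" "t \<in> carrier (K j)"
  shows "gen i s \<otimes>\<^bsub>SG\<^esub> gen j t = gen j t \<otimes>\<^bsub>SG\<^esub> gen i (s \<otimes>\<^bsub>K i\<^esub> shift i j)"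
proof -
  let ?R = "structure_rels Q tri" and ?a = "point i s" and ?b = "point j t"
  let ?c = "point i (s \<otimes>\<^bsub>K i\<^esub> shift i j)"
  have Q: "?a \<in> Q" "?b \<in> Q" "?c \<in> Q"
    using assms point shift_closed by simp_all
  have "([(?a, True), (?b, True)], [(?b, True), (?c, True)]) \<in> ?R"
    unfolding structure_rels_def using Q tri_point[OF assms] by force
  then have "([(?a, True), (?b, True)], [(?b, True), (?c, True)]) \<in> word_cong Q ?R"
    using word_cong.rel[of "[]" Q "[]" _ _ ?R] Q by fastforce
  then show ?thesis
    using Q by (simp add: gen_def SG_def structure_group_eq presented_gen_def mult_presented_group
        word_class_eq_iff)
qed

text \<open>The presentation restated for generators indexed by pairs (i, s). It supplies both the
  projection onto Z^r and the permutation representation.\<close>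

lemma SG_universal:
  assumes H: "group H" and F: "\<And>i s. i \<in> I \<Longrightarrow> s \<in> carrier (K i) \<Longrightarrow> F i s \<in> carrier H"
    and rel: "\<And>i s j t. i \<in> I \<Longrightarrow> s \<in> carrier (K i) \<Longrightarrow> j \<in> I \<Longrightarrow> t \<in> carrier (K j) \<Longrightarrow>
      F i s \<otimes>\<^bsub>H\<^esub> F j t = F j t \<otimes>\<^bsub>H\<^esub> F i (s \<otimes>\<^bsub>K i\<^esub> shift i j)"
  obtains h where "group_hom SG H h"
    and "\<And>i s. i \<in> I \<Longrightarrow> s \<in> carrier (K i) \<Longrightarrow> h (gen i s) = F i s"
proof -
  interpret H: group H
    by fact
  define F' where "F' a = F (fst (f a)) (snd (f a))" for a
  have F'_point: "F' (point i s) = F i s" if "i \<in> I" "s \<in> carrier (K i)" for i s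
    using that by (simp add: F'_def point)
  have F': "F' \<in> Q \<rightarrow> carrier H"
    using ex_point F F'_point by (metis Pi_I)
  have "word_eval H F' l = word_eval H F' l'" if "(l, l') \<in> structure_rels Q tri" for l l'
  proof -
    obtain a b where ab: "a \<in> Q" "b \<in> Q" "l = [(a, True), (b, True)]" "l' = [(b, True), (tri a b, True)]"
      using \<open>(l, l') \<in> structure_rels Q tri\<close> by (auto simp: structure_rels_def)
    obtain i s where ind: "i \<in> I" "s \<in> carrier (K i)" "a = point i s"
      using ex_point[OF ab(1)] .
    obtain j t where jt: "j \<in> I" "t \<in> carrier (K j)" "b = point j t"
      using ex_point[OF ab(2)] .
    have st: "s \<otimes>\<^bsub>K i\<^esub> shift i j \<in> carrier (K i)"
      using ind shift_closed by simp
    show ?thesis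
      using rel[OF ind(1,2) jt(1,2)] F ind jt st
      by (simp add: ab tri_point F'_point)
  qed
  then obtain h where "h \<in> hom SG H"
    and h: "\<And>a. a \<in> Q \<Longrightarrow> h (presented_gen Q (structure_rels Q tri) a) = F' a"
    unfolding SG_def structure_group_eq using H.presented_group_universal[OF F'] by metis
  then have "group_hom SG H h"
    by unfold_locales
  then show thesis
    by (rule that) (simp add: gen_def h point F'_point)
qed

text \<open>By \<open>gen_conj\<close> this is the commutator of the generator at the neutral
  element of orbit \<open>i\<close> with any generator from orbit \<open>j\<close>.\<close>

definition comm :: "nat \<Rightarrow> nat \<Rightarrow> 'a word set" where
  "comm i j = inv\<^bsub>SG\<^esub> gen i \<one>\<^bsub>K i\<^esub> \<otimes>\<^bsub>SG\<^esub> gen i (shift i j)"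

lemma gen_conj:
  assumes "i \<in> I" "s \<in> carrier (K i)" "j \<in> I" "t \<in> carrier (K j)"
  shows "gen i (s \<otimes>\<^bsub>K i\<^esub> shift i j) = inv\<^bsub>SG\<^esub> gen j t \<otimes>\<^bsub>SG\<^esub> gen i s \<otimes>\<^bsub>SG\<^esub> gen j t"
proof -
  have "s \<otimes>\<^bsub>K i\<^esub> shift i j \<in> carrier (K i)"
    using assms shift_closed by simp
  then show ?thesis
    using assms gen_relation[OF assms] by (simp add: SG.m_assoc) (simp flip: SG.m_assoc)
qed

text \<open>Read in two ways, the commutator of \<open>gen i s\<close> and \<open>gen j t\<close> depends neither on \<open>t\<close> nor on \<open>s\<close>.\<close>

lemma gen_shift_quotient:
  assumes "i \<in> I" "s \<in> carrier (K i)" "j \<in> I" "t \<in> carrier (K j)"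
  shows "inv\<^bsub>SG\<^esub> gen i s \<otimes>\<^bsub>SG\<^esub> gen i (s \<otimes>\<^bsub>K i\<^esub> shift i j)
    = inv\<^bsub>SG\<^esub> gen j (t \<otimes>\<^bsub>K j\<^esub> shift j i) \<otimes>\<^bsub>SG\<^esub> gen j t"
  using assms
  by (simp add: gen_conj[OF assms] gen_conj[OF assms(3,4,1,2)] SG.inv_mult_group SG.m_assoc)

text \<open>The right side of \<open>gen_shift_quotient\<close> does not contain \<open>s\<close>,
  so the left side takes the same value at \<open>s\<close> as at the neutral element.\<close>

lemma comm_eq:
  assumes "i \<in> I" "s \<in> carrier (K i)" "j \<in> I"
  shows "inv\<^bsub>SG\<^esub> gen i s \<otimes>\<^bsub>SG\<^esub> gen i (s \<otimes>\<^bsub>K i\<^esub> shift i j) = comm i j"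
proof -
  have "inv\<^bsub>SG\<^esub> gen i \<one>\<^bsub>K i\<^esub> \<otimes>\<^bsub>SG\<^esub> gen i (\<one>\<^bsub>K i\<^esub> \<otimes>\<^bsub>K i\<^esub> shift i j) = comm i j"
    unfolding comm_def K.l_one[OF shift_closed[OF assms(1)]] ..
  then show ?thesis
    unfolding gen_shift_quotient[OF assms K.one_closed]
      gen_shift_quotient[OF assms(1) K.one_closed assms(3) K.one_closed] .
qed

lemma comm_closed [simp]: "i \<in> I \<Longrightarrow> comm i j \<in> carrier SG"
  by (simp add: comm_def shift_closed)

text \<open>Exchanging the two entries inverts a commutator; \<open>gen_shift_quotient\<close> says
  this at the two neutral elements. These equations are why the relators of the parameter group hold
  in the structure group.\<close>

lemma comm_mult_comm:
  assumes "i \<in> I" "j \<in> I"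
  shows "comm i j \<otimes>\<^bsub>SG\<^esub> comm j i = \<one>\<^bsub>SG\<^esub>"
proof -
  have "comm i j = inv\<^bsub>SG\<^esub> gen j (shift j i) \<otimes>\<^bsub>SG\<^esub> gen j \<one>\<^bsub>K j\<^esub>"
    using gen_shift_quotient[OF assms(1) K.one_closed assms(2) K.one_closed]
    unfolding comm_def K.l_one[OF shift_closed[OF assms(1)]] K.l_one[OF shift_closed[OF assms(2)]] .
  then show ?thesis
    using assms shift_closed[OF assms(2)]
    by (simp add: comm_def SG.m_assoc SG.inv_solve_left flip: SG.m_assoc[of "gen j \<one>\<^bsub>K j\<^esub>"])
qed

lemma gen_shift:
  assumes "i \<in> I" "s \<in> carrier (K i)" "j \<in> I"
  shows "gen i (s \<otimes>\<^bsub>K i\<^esub> shift i j) = gen i s \<otimes>\<^bsub>SG\<^esub> comm i j"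
  using comm_eq[OF assms] assms shift_closed SG.inv_solve_left by (metis K.m_closed comm_closed gen_closed)

text \<open>Conjugating by a generator from orbit \<open>k\<close> moves the base point of the
  commutator from the neutral element to \<open>shift i k\<close>, and by \<open>comm_eq\<close> the
  commutator is the same from every base point.\<close>

lemma comm_center:
  assumes "i \<in> I" "j \<in> I"
  shows "comm i j \<in> center SG"
proof (rule SG.center_generators[OF _ generate_gen])
  show "comm i j \<in> carrier SG" "(\<Union>i\<in>I. gen i ` carrier (K i)) \<subseteq> carrier SG"
    using assms by auto
  fix a assume "a \<in> (\<Union>i\<in>I. gen i ` carrier (K i))"
  then obtain k u where ku: "k \<in> I" "u \<in> carrier (K k)" "a = gen k u"
    by blast
  note one = K.one_closed[of i]
  have s: "shift i j \<in> carrier (K i)" "shift i k \<in> carrier (K i)"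
    using shift_closed[OF assms(1)] by simp_all
  have a: "a \<in> carrier SG"
    using ku by simp
  have g: "gen i \<one>\<^bsub>K i\<^esub> \<in> carrier SG" "gen i (shift i j) \<in> carrier SG"
    using assms s by simp_all
  have conj1: "gen i (shift i k) = inv\<^bsub>SG\<^esub> a \<otimes>\<^bsub>SG\<^esub> gen i \<one>\<^bsub>K i\<^esub> \<otimes>\<^bsub>SG\<^esub> a"
    using gen_conj[OF assms(1) one ku(1,2)] s by (simp add: ku(3))
  have "gen i (shift i k \<otimes>\<^bsub>K i\<^esub> shift i j) = inv\<^bsub>SG\<^esub> a \<otimes>\<^bsub>SG\<^esub> gen i (shift i j) \<otimes>\<^bsub>SG\<^esub> a"
    using gen_conj[OF assms(1) s(1) ku(1,2)] s by (simp add: ku(3) K.m_comm)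
  then have "comm i j = inv\<^bsub>SG\<^esub> gen i (shift i k) \<otimes>\<^bsub>SG\<^esub> (inv\<^bsub>SG\<^esub> a \<otimes>\<^bsub>SG\<^esub> gen i (shift i j) \<otimes>\<^bsub>SG\<^esub> a)"
    using comm_eq[OF assms(1) s(2) assms(2)] by simp
  also have "\<dots> = inv\<^bsub>SG\<^esub> a \<otimes>\<^bsub>SG\<^esub> comm i j \<otimes>\<^bsub>SG\<^esub> a"
    unfolding conj1 comm_def using a g
    by (simp add: SG.inv_mult_group SG.m_assoc) (simp flip: SG.m_assoc)
  finally have eq: "comm i j = inv\<^bsub>SG\<^esub> a \<otimes>\<^bsub>SG\<^esub> comm i j \<otimes>\<^bsub>SG\<^esub> a" .
  have "a \<otimes>\<^bsub>SG\<^esub> comm i j = a \<otimes>\<^bsub>SG\<^esub> (inv\<^bsub>SG\<^esub> a \<otimes>\<^bsub>SG\<^esub> comm i j \<otimes>\<^bsub>SG\<^esub> a)"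
    using eq by simp
  also have "\<dots> = comm i j \<otimes>\<^bsub>SG\<^esub> a"
    using a assms by (simp flip: SG.m_assoc)
  finally show "comm i j \<otimes>\<^bsub>SG\<^esub> a = a \<otimes>\<^bsub>SG\<^esub> comm i j"
    by simp
qed

lemma comm_derived:
  assumes "i \<in> I" "j \<in> I"
  shows "comm i j \<in> derived SG (carrier SG)"
proof -
  have "comm i j = inv\<^bsub>SG\<^esub> gen i \<one>\<^bsub>K i\<^esub> \<otimes>\<^bsub>SG\<^esub> inv\<^bsub>SG\<^esub> gen j \<one>\<^bsub>K j\<^esub>
      \<otimes>\<^bsub>SG\<^esub> gen i \<one>\<^bsub>K i\<^esub> \<otimes>\<^bsub>SG\<^esub> gen j \<one>\<^bsub>K j\<^esub>"
    using assms gen_conj[OF assms(1) K.one_closed assms(2) K.one_closed]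
    unfolding comm_def K.l_one[OF shift_closed[OF assms(1)]] by (simp add: SG.m_assoc)
  then show ?thesis
    using SG.commutator_in_derived assms by simp
qed

text \<open>As a target for the parameter group this subgroup is commutative, which finite products
  require, and it keeps the image inside the derived subgroup from the start.\<close>

definition "Z = center SG \<inter> derived SG (carrier SG)"

lemma subgroup_Z: "subgroup Z SG"
  unfolding Z_def by (intro subgroup_Int SG.center_subgroup SG.derived_is_subgroup) simp

sublocale Z: comm_group "SG\<lparr>carrier := Z\<rparr>"
  by (rule SG.comm_group_central[OF subgroup_Z]) (simp add: Z_def)

section \<open>Displacements from the neutral element of an orbit\<close>

definition disp :: "nat \<Rightarrow> (nat \<Rightarrow>\<^sub>0 int) set \<Rightarrow> 'a word set" where
  "disp i t = inv\<^bsub>SG\<^esub> gen i \<one>\<^bsub>K i\<^esub> \<otimes>\<^bsub>SG\<^esub> gen i t"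

lemma disp_closed: "i \<in> I \<Longrightarrow> t \<in> carrier (K i) \<Longrightarrow> disp i t \<in> carrier SG"
  by (simp add: disp_def)

lemma disp_shift: "disp i (shift i j) = comm i j"
  by (simp add: disp_def comm_def)

text \<open>The elements \<open>t\<close> whose displacement lies in \<open>Z\<close> and is the
  same from every base point \<open>s\<close> form a subgroup of \<open>K i\<close>. It contains the
  shifts, whose displacements are the central commutators \<open>comm i j\<close>, and the shifts
  generate \<open>K i\<close>.\<close>

lemma disp_central:
  assumes i: "i \<in> I" and t: "t \<in> carrier (K i)"
  shows "disp i t \<in> Z \<and>
    (\<forall>s\<in>carrier (K i). gen i (s \<otimes>\<^bsub>K i\<^esub> t) = gen i s \<otimes>\<^bsub>SG\<^esub> disp i t)"
proof -
  let ?H = "{t \<in> carrier (K i). disp i t \<in> Z \<and>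
    (\<forall>s\<in>carrier (K i). gen i (s \<otimes>\<^bsub>K i\<^esub> t) = gen i s \<otimes>\<^bsub>SG\<^esub> disp i t)}"
  have g1: "gen i \<one>\<^bsub>K i\<^esub> \<in> carrier SG"
    using i by simp
  \<comment> \<open>An element of \<open>Z\<close> that realises multiplication by \<open>t\<close>
    must be \<open>disp i t\<close>, as the neutral base point shows. Each closure property thus
    only needs some such \<open>z\<close>.\<close>
  have H: "t \<in> ?H" if "t \<in> carrier (K i)" "z \<in> Z"
    "\<And>s. s \<in> carrier (K i) \<Longrightarrow> gen i (s \<otimes>\<^bsub>K i\<^esub> t) = gen i s \<otimes>\<^bsub>SG\<^esub> z" for t z
  proof -
    have z: "z \<in> carrier SG"
      using that(2) subgroup.subset[OF subgroup_Z] by blast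
    have "gen i t = gen i \<one>\<^bsub>K i\<^esub> \<otimes>\<^bsub>SG\<^esub> z"
      using that(3)[OF K.one_closed] that(1) by simp
    then have "disp i t = z"
      using z g1 by (simp add: disp_def flip: SG.m_assoc)
    then show ?thesis
      using that by simp
  qed
  have "subgroup ?H (K i)"
  proof (rule K.subgroupI)
    have "\<one>\<^bsub>K i\<^esub> \<in> ?H"
      by (rule H[of _ "\<one>\<^bsub>SG\<^esub>"]) (use i subgroup.one_closed[OF subgroup_Z] in auto)
    then show "?H \<noteq> {}"
      by blast
  next
    fix t assume t: "t \<in> ?H"
    then have z: "disp i t \<in> carrier SG"
      using subgroup.subset[OF subgroup_Z] by blast
    show "inv\<^bsub>K i\<^esub> t \<in> ?H"
    proof (rule H[of _ "inv\<^bsub>SG\<^esub> disp i t"])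
      fix s assume s: "s \<in> carrier (K i)"
      have "gen i (s \<otimes>\<^bsub>K i\<^esub> inv\<^bsub>K i\<^esub> t \<otimes>\<^bsub>K i\<^esub> t) = gen i (s \<otimes>\<^bsub>K i\<^esub> inv\<^bsub>K i\<^esub> t) \<otimes>\<^bsub>SG\<^esub> disp i t"
        using s t by simp
      moreover have "s \<otimes>\<^bsub>K i\<^esub> inv\<^bsub>K i\<^esub> t \<otimes>\<^bsub>K i\<^esub> t = s"
        using s t by (simp add: K.m_assoc)
      ultimately show "gen i (s \<otimes>\<^bsub>K i\<^esub> inv\<^bsub>K i\<^esub> t) = gen i s \<otimes>\<^bsub>SG\<^esub> inv\<^bsub>SG\<^esub> disp i t"
        using s t z i by (simp add: SG.m_assoc)
    qed (use t subgroup.m_inv_closed[OF subgroup_Z] in auto)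
  next
    fix t u assume tu: "t \<in> ?H" "u \<in> ?H"
    then have z: "disp i t \<in> carrier SG" "disp i u \<in> carrier SG"
      using subgroup.subset[OF subgroup_Z] by blast+
    show "t \<otimes>\<^bsub>K i\<^esub> u \<in> ?H"
    proof (rule H[of _ "disp i t \<otimes>\<^bsub>SG\<^esub> disp i u"])
      fix s assume s: "s \<in> carrier (K i)"
      have "gen i (s \<otimes>\<^bsub>K i\<^esub> t \<otimes>\<^bsub>K i\<^esub> u) = gen i s \<otimes>\<^bsub>SG\<^esub> disp i t \<otimes>\<^bsub>SG\<^esub> disp i u"
        using s tu by simp
      then show "gen i (s \<otimes>\<^bsub>K i\<^esub> (t \<otimes>\<^bsub>K i\<^esub> u)) = gen i s \<otimes>\<^bsub>SG\<^esub> (disp i t \<otimes>\<^bsub>SG\<^esub> disp i u)"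
        using s tu z i by (simp add: SG.m_assoc K.m_assoc)
    qed (use tu subgroup.m_closed[OF subgroup_Z] in auto)
  qed auto
  moreover have "shift i ` I \<subseteq> ?H"
  proof (rule image_subsetI)
    fix j assume j: "j \<in> I"
    show "shift i j \<in> ?H"
      by (rule H[of _ "comm i j"])
        (use i j shift_closed gen_shift comm_center comm_derived in \<open>simp_all add: Z_def\<close>)
  qed
  ultimately have "generate (K i) (shift i ` I) \<subseteq> ?H"
    by (intro K.generate_subgroup_incl)
  then show ?thesis
    using t generate_shift[OF i] by blast
qed

lemma gen_mult:
  "i \<in> I \<Longrightarrow> s \<in> carrier (K i) \<Longrightarrow> t \<in> carrier (K i) \<Longrightarrow>
    gen i (s \<otimes>\<^bsub>K i\<^esub> t) = gen i s \<otimes>\<^bsub>SG\<^esub> disp i t"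
  using disp_central by blast

lemma gen_eq: "i \<in> I \<Longrightarrow> t \<in> carrier (K i) \<Longrightarrow> gen i t = gen i \<one>\<^bsub>K i\<^esub> \<otimes>\<^bsub>SG\<^esub> disp i t"
  using gen_mult[of i "\<one>\<^bsub>K i\<^esub>" t] by simp

lemma disp_hom:
  assumes "i \<in> I"
  shows "disp i \<in> hom (K i) (SG\<lparr>carrier := Z\<rparr>)"
proof (rule homI)
  fix s t assume st: "s \<in> carrier (K i)" "t \<in> carrier (K i)"
  then show "disp i (s \<otimes>\<^bsub>K i\<^esub> t) = disp i s \<otimes>\<^bsub>SG\<lparr>carrier := Z\<rparr>\<^esub> disp i t"
    using assms disp_closed[OF assms st(2)] by (simp add: disp_def[of i "s \<otimes>\<^bsub>K i\<^esub> t"] gen_mult)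
      (simp add: disp_def[of i s] SG.m_assoc)
qed (use disp_central assms in auto)

subsection \<open>The parameter group inside the structure group\<close>

abbreviation "GP \<equiv> GM_product r M"
abbreviation "PQ \<equiv> param_quotient r M"

definition "GP_rels = {product_gen r M i (mod_diff r j i) \<otimes>\<^bsub>GP\<^esub> product_gen r M j (mod_diff r i j)
  | i j. 1 \<le> i \<and> i < j \<and> j \<le> r}"

definition "GP_sub = generate GP GP_rels"

definition single :: "nat \<Rightarrow> (nat \<Rightarrow>\<^sub>0 int) set \<Rightarrow> nat \<Rightarrow> (nat \<Rightarrow>\<^sub>0 int) set" where
  "single = product_single I K"

lemma product_gen_eq: "product_gen r M i (mod_diff r j i) = single i (shift i j)"
  by (simp add: product_gen_def single_def product_single_def)

sublocale GP: comm_group GP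
  unfolding GM_product_def by (rule comm_group_product_group) (rule comm_group_GM)

lemma single_hom: "i \<in> I \<Longrightarrow> single i \<in> hom (K i) GP"
  unfolding single_def GM_product_def by (rule product_single_hom) auto

lemma single_closed: "i \<in> I \<Longrightarrow> a \<in> carrier (K i) \<Longrightarrow> single i a \<in> carrier GP"
  using single_hom by (rule hom_in_carrier)

lemma generate_single: "generate GP (\<Union>i\<in>I. single i ` carrier (K i)) = carrier GP"
  unfolding single_def GM_product_def by (rule generate_product_single) auto

lemma GP_rels_subset: "GP_rels \<subseteq> carrier GP"
  unfolding GP_rels_def product_gen_eq
  by (auto intro!: GP.m_closed single_closed shift_closed)

lemma subgroup_GP_sub: "subgroup GP_sub GP"
  unfolding GP_sub_def by (rule GP.generate_is_subgroup[OF GP_rels_subset])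

lemma PQ_eq: "PQ = GP Mod GP_sub"
  by (simp add: param_quotient_def GP_sub_def GP_rels_def)

sublocale PQ: comm_group PQ
  unfolding PQ_eq by (rule GP.abelian_FactGroup[OF subgroup_GP_sub])

definition cls :: "(nat \<Rightarrow> (nat \<Rightarrow>\<^sub>0 int) set) \<Rightarrow> (nat \<Rightarrow> (nat \<Rightarrow>\<^sub>0 int) set) set" where
  "cls s = GP_sub #>\<^bsub>GP\<^esub> s"

lemma GP_sub_normal: "GP_sub \<lhd> GP"
  using subgroup_GP_sub by (simp only: GP.normal_iff_subgroup)

sublocale cls: group_hom GP PQ cls
  unfolding group_hom_def group_hom_axioms_def cls_def[abs_def]
  using normal.r_coset_hom_Mod[OF GP_sub_normal] GP.group_axioms PQ.group_axioms
  by (simp add: PQ_eq)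

lemma carrier_PQ: "carrier PQ = cls ` carrier GP"
  by (simp add: PQ_eq carrier_FactGroup cls_def[abs_def])

definition emb_GP :: "(nat \<Rightarrow> (nat \<Rightarrow>\<^sub>0 int) set) \<Rightarrow> 'a word set" where
  "emb_GP s = finprod (SG\<lparr>carrier := Z\<rparr>) (\<lambda>i. disp i (s i)) I"

sublocale emb_GP: group_hom GP "SG\<lparr>carrier := Z\<rparr>" emb_GP
proof -
  have "emb_GP \<in> hom GP (SG\<lparr>carrier := Z\<rparr>)"
    unfolding GM_product_def emb_GP_def[abs_def] by (rule Z.finprod_in_hom) (auto intro: disp_hom)
  then show "group_hom GP (SG\<lparr>carrier := Z\<rparr>) emb_GP"
    by unfold_locales
qed

lemma emb_GP_single:
  assumes "i \<in> I" "a \<in> carrier (K i)"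
  shows "emb_GP (single i a) = disp i a"
  unfolding emb_GP_def single_def
  by (rule Z.finprod_product_single) (use assms disp_hom in auto)

lemma GP_sub_kernel: "GP_sub \<subseteq> kernel GP (SG\<lparr>carrier := Z\<rparr>) emb_GP"
  unfolding GP_sub_def
proof (rule GP.generate_subgroup_incl[OF _ emb_GP.subgroup_kernel])
  show "GP_rels \<subseteq> kernel GP (SG\<lparr>carrier := Z\<rparr>) emb_GP"
  proof
    fix x assume "x \<in> GP_rels"
    then obtain i j where "1 \<le> i" "i < j" "j \<le> r"
      and x: "x = single i (shift i j) \<otimes>\<^bsub>GP\<^esub> single j (shift j i)"
      unfolding GP_rels_def product_gen_eq by blast
    then have ij: "i \<in> I" "j \<in> I"
      by auto
    have c: "single i (shift i j) \<in> carrier GP" "single j (shift j i) \<in> carrier GP"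
      using ij single_closed shift_closed by blast+
    have "emb_GP x = comm i j \<otimes>\<^bsub>SG\<^esub> comm j i"
      using emb_GP.hom_mult[OF c] emb_GP_single ij x shift_closed disp_shift by simp
    then show "x \<in> kernel GP (SG\<lparr>carrier := Z\<rparr>) emb_GP"
      using c comm_mult_comm[OF ij] by (simp add: kernel_def x)
  qed
qed

lemma ex_emb:
  obtains emb where "emb \<in> hom PQ (SG\<lparr>carrier := Z\<rparr>)"
    "\<And>s. s \<in> carrier GP \<Longrightarrow> emb (cls s) = emb_GP s"
  using emb_GP.FactGroup_universal_kernel[OF GP_sub_normal GP_sub_kernel]
  unfolding PQ_eq cls_def by blast

subsection \<open>A faithful representation of the parameter group\<close>

definition part :: "nat \<Rightarrow> (nat \<Rightarrow>\<^sub>0 int) set \<Rightarrow> (nat \<Rightarrow> (nat \<Rightarrow>\<^sub>0 int) set) set" where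
  "part i a = cls (single i a)"

lemma part_closed [simp]: "i \<in> I \<Longrightarrow> a \<in> carrier (K i) \<Longrightarrow> part i a \<in> carrier PQ"
  by (simp add: part_def single_closed)

lemma part_mult:
  "i \<in> I \<Longrightarrow> a \<in> carrier (K i) \<Longrightarrow> b \<in> carrier (K i) \<Longrightarrow>
    part i (a \<otimes>\<^bsub>K i\<^esub> b) = part i a \<otimes>\<^bsub>PQ\<^esub> part i b"
  by (simp add: part_def hom_mult[OF single_hom] single_closed)

lemma part_one: "i \<in> I \<Longrightarrow> part i \<one>\<^bsub>K i\<^esub> = \<one>\<^bsub>PQ\<^esub>"
  by (simp add: part_def hom_one[OF single_hom])

abbreviation "cocycle i j \<equiv> part i (shift i j)"

lemma cocycle_self: "i \<in> I \<Longrightarrow> cocycle i i = \<one>\<^bsub>PQ\<^esub>"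
  unfolding shift_self by (rule part_one)

lemma cocycle_antisym_less:
  assumes "i \<in> I" "j \<in> I" "i < j"
  shows "cocycle i j \<otimes>\<^bsub>PQ\<^esub> cocycle j i = \<one>\<^bsub>PQ\<^esub>"
proof -
  let ?x = "single i (shift i j) \<otimes>\<^bsub>GP\<^esub> single j (shift j i)"
  have c: "single i (shift i j) \<in> carrier GP" "single j (shift j i) \<in> carrier GP"
    using assms single_closed shift_closed by blast+
  have "?x \<in> GP_sub"
    unfolding GP_sub_def GP_rels_def product_gen_eq using assms by (intro generate.incl) auto
  then have "cls ?x = \<one>\<^bsub>PQ\<^esub>"
    using subgroup.rcos_const[OF subgroup_GP_sub GP.group_axioms] by (simp add: cls_def PQ_eq)
  then show ?thesis
    using c by (simp add: part_def)
qed

text \<open>The relators give the case \<open>i < j\<close>. The case \<open>i > j\<close> follows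
  by commutativity, and on the diagonal the shift is trivial.\<close>

lemma cocycle_antisym:
  assumes "i \<in> I" "j \<in> I"
  shows "cocycle i j \<otimes>\<^bsub>PQ\<^esub> cocycle j i = \<one>\<^bsub>PQ\<^esub>"
proof (cases i j rule: linorder_cases)
  case less
  then show ?thesis
    by (rule cocycle_antisym_less[OF assms])
next
  case equal
  then show ?thesis
    using assms by (simp add: cocycle_self del: mod_diff_self)
next
  case greater
  have "cocycle i j \<otimes>\<^bsub>PQ\<^esub> cocycle j i = cocycle j i \<otimes>\<^bsub>PQ\<^esub> cocycle i j"
    using assms shift_closed by (intro PQ.m_comm) auto
  then show ?thesis
    using cocycle_antisym_less[OF assms(2,1) greater] by simp
qed

text \<open>The value at (e_i, v), with e_i the unit vector, of the bilinear form that keeps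
  \<open>cocycle i k\<close> for \<open>i < k\<close> and is trivial elsewhere. The
  antisymmetrisation of this form is \<open>cocycle\<close>.\<close>

definition twist :: "nat \<Rightarrow> (nat \<Rightarrow> int) \<Rightarrow> (nat \<Rightarrow> (nat \<Rightarrow>\<^sub>0 int) set) set" where
  "twist i v = (\<Otimes>\<^bsub>PQ\<^esub>k\<in>{i<..r}. cocycle i k [^]\<^bsub>PQ\<^esub> v k)"

lemma cocycle_closed [simp]: "i \<in> I \<Longrightarrow> cocycle i k \<in> carrier PQ"
  by (rule part_closed[OF _ shift_closed])

lemma twist_closed [simp]: "i \<in> I \<Longrightarrow> twist i v \<in> carrier PQ"
  unfolding twist_def by (rule PQ.finprod_closed) auto

text \<open>Only coordinates above \<open>i\<close> enter. The case \<open>j = i\<close> says that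
  \<open>step i\<close> does not disturb its own factor.\<close>

lemma twist_upd_ge:
  assumes "i \<in> I" "j \<le> i"
  shows "twist i (v(j := c)) = twist i v"
  unfolding twist_def
  by (rule PQ.finprod_cong') (use assms in auto)

lemma twist_upd:
  assumes "i \<in> I" "j \<in> I" "i < j"
  shows "twist i (v(j := v j + 1)) = twist i v \<otimes>\<^bsub>PQ\<^esub> cocycle i j"
proof -
  have c: "(\<lambda>k. cocycle i k [^]\<^bsub>PQ\<^esub> v k) \<in> {i<..r} \<rightarrow> carrier PQ"
    "(\<lambda>k. if k = j then cocycle i k else \<one>\<^bsub>PQ\<^esub>) \<in> {i<..r} \<rightarrow> carrier PQ"
    using assms(1) by auto
  have "twist i (v(j := v j + 1)) = (\<Otimes>\<^bsub>PQ\<^esub>k\<in>{i<..r}.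
      cocycle i k [^]\<^bsub>PQ\<^esub> v k \<otimes>\<^bsub>PQ\<^esub> (if k = j then cocycle i k else \<one>\<^bsub>PQ\<^esub>))"
    unfolding twist_def by (rule PQ.finprod_cong') (use assms(1) in \<open>auto simp: PQ.int_pow_mult\<close>)
  also have "\<dots> = twist i v \<otimes>\<^bsub>PQ\<^esub> (\<Otimes>\<^bsub>PQ\<^esub>k\<in>{i<..r}. if k = j then cocycle i k else \<one>\<^bsub>PQ\<^esub>)"
    unfolding twist_def by (rule PQ.finprod_multf[OF c])
  also have "(\<Otimes>\<^bsub>PQ\<^esub>k\<in>{i<..r}. if k = j then cocycle i k else \<one>\<^bsub>PQ\<^esub>) = cocycle i j"
    by (rule PQ.finprod_singleton_swap) (use assms in auto)
  finally show ?thesis .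
qed

text \<open>The representation space is the underlying set of the central extension of \<open>\<int>\<^sup>r\<close> by the
  parameter group whose cocycle is the upper triangular half of \<open>cocycle\<close>; the maps below are the
  left translations by the lifts of the generators.\<close>

definition "E = (UNIV :: (nat \<Rightarrow> int) set) \<times> carrier PQ"

definition step :: "nat \<Rightarrow> (nat \<Rightarrow>\<^sub>0 int) set \<Rightarrow> (nat \<Rightarrow> int) \<times> (nat \<Rightarrow> (nat \<Rightarrow>\<^sub>0 int) set) set \<Rightarrow>
    (nat \<Rightarrow> int) \<times> (nat \<Rightarrow> (nat \<Rightarrow>\<^sub>0 int) set) set" where
  "step i s = (\<lambda>(v, p)\<in>E. (v(i := v i + 1), p \<otimes>\<^bsub>PQ\<^esub> part i s \<otimes>\<^bsub>PQ\<^esub> twist i v))"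

definition trans :: "(nat \<Rightarrow> (nat \<Rightarrow>\<^sub>0 int) set) set \<Rightarrow> (nat \<Rightarrow> int) \<times> (nat \<Rightarrow> (nat \<Rightarrow>\<^sub>0 int) set) set \<Rightarrow>
    (nat \<Rightarrow> int) \<times> (nat \<Rightarrow> (nat \<Rightarrow>\<^sub>0 int) set) set" where
  "trans q = (\<lambda>(v, p)\<in>E. (v, p \<otimes>\<^bsub>PQ\<^esub> q))"

lemma step_apply: "p \<in> carrier PQ \<Longrightarrow>
    step i s (v, p) = (v(i := v i + 1), p \<otimes>\<^bsub>PQ\<^esub> part i s \<otimes>\<^bsub>PQ\<^esub> twist i v)"
  by (simp add: step_def E_def)

lemma trans_apply: "p \<in> carrier PQ \<Longrightarrow> trans q (v, p) = (v, p \<otimes>\<^bsub>PQ\<^esub> q)"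
  by (simp add: trans_def E_def)

lemma trans_Bij:
  assumes "q \<in> carrier PQ"
  shows "trans q \<in> Bij E"
proof -
  have "bij_betw (trans q) E E"
    by (rule bij_betw_byWitness[where f' = "trans (inv\<^bsub>PQ\<^esub> q)"])
      (use assms in \<open>auto simp: E_def trans_apply PQ.m_assoc\<close>)
  then show ?thesis
    by (simp add: Bij_def trans_def)
qed

lemma step_Bij:
  assumes "i \<in> I" "s \<in> carrier (K i)"
  shows "step i s \<in> Bij E"
proof -
  \<comment> \<open>The factor to be removed was formed before the increment; it may be computed
    from \<open>v\<close> itself because \<open>twist i\<close> does not see coordinate
    \<open>i\<close>.\<close>
  let ?g = "\<lambda>(v, p). (v(i := v i - 1), p \<otimes>\<^bsub>PQ\<^esub> inv\<^bsub>PQ\<^esub> (part i s \<otimes>\<^bsub>PQ\<^esub> twist i v))"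
  have "bij_betw (step i s) E E"
    by (rule bij_betw_byWitness[where f' = ?g])
      (use assms in \<open>auto simp: E_def step_apply PQ.m_assoc twist_upd_ge\<close>)
  then show ?thesis
    by (simp add: Bij_def step_def)
qed

lemma mult_BijGroup:
  "g \<in> Bij S \<Longrightarrow> h \<in> Bij S \<Longrightarrow> g \<otimes>\<^bsub>BijGroup S\<^esub> h = compose S g h"
  by (simp add: BijGroup_def)

lemma trans_hom: "group_hom PQ (BijGroup E) trans"
proof -
  have "trans \<in> hom PQ (BijGroup E)"
  proof (rule homI)
    fix p q assume pq: "p \<in> carrier PQ" "q \<in> carrier PQ"
    have "trans (p \<otimes>\<^bsub>PQ\<^esub> q) x = compose E (trans p) (trans q) x" for x
      using pq by (cases x) (auto simp: trans_def compose_def E_def PQ.m_ac)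
    then show "trans (p \<otimes>\<^bsub>PQ\<^esub> q) = trans p \<otimes>\<^bsub>BijGroup E\<^esub> trans q"
      using pq trans_Bij by (simp add: mult_BijGroup fun_eq_iff)
  qed (simp add: BijGroup_def trans_Bij)
  then show ?thesis
    using group_BijGroup PQ.group_axioms by (simp add: group_hom_def group_hom_axioms_def)
qed

text \<open>For \<open>i < j\<close> the increment at \<open>j\<close> contributes
  \<open>cocycle i j\<close> to the left side. For \<open>i > j\<close> the increment at
  \<open>i\<close> contributes \<open>cocycle j i\<close> to the right side, where it cancels
  against \<open>cocycle i j\<close>.\<close>

lemma twist_exchange:
  assumes "i \<in> I" "j \<in> I"
  shows "twist j v \<otimes>\<^bsub>PQ\<^esub> twist i (v(j := v j + 1))
    = cocycle i j \<otimes>\<^bsub>PQ\<^esub> (twist i v \<otimes>\<^bsub>PQ\<^esub> twist j (v(i := v i + 1)))"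
proof (cases i j rule: linorder_cases)
  case less
  then show ?thesis
    using assms by (simp add: twist_upd twist_upd_ge PQ.m_ac)
next
  case equal
  then show ?thesis
    using assms by (simp add: cocycle_self del: mod_diff_self)
next
  case greater
  then have "cocycle i j \<otimes>\<^bsub>PQ\<^esub> (twist i v \<otimes>\<^bsub>PQ\<^esub> twist j (v(i := v i + 1)))
      = (cocycle i j \<otimes>\<^bsub>PQ\<^esub> cocycle j i) \<otimes>\<^bsub>PQ\<^esub> (twist j v \<otimes>\<^bsub>PQ\<^esub> twist i v)"
    using assms by (simp add: twist_upd PQ.m_ac)
  then show ?thesis
    using assms greater by (simp add: cocycle_antisym twist_upd_ge)
qed

lemma step_relation:
  assumes "i \<in> I" "s \<in> carrier (K i)" "j \<in> I" "t \<in> carrier (K j)"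
  shows "step i s \<otimes>\<^bsub>BijGroup E\<^esub> step j t
    = step j t \<otimes>\<^bsub>BijGroup E\<^esub> step i (s \<otimes>\<^bsub>K i\<^esub> shift i j)"
proof -
  have st: "s \<otimes>\<^bsub>K i\<^esub> shift i j \<in> carrier (K i)"
    using assms shift_closed by simp
  have "step i s (step j t (v, p)) = step j t (step i (s \<otimes>\<^bsub>K i\<^esub> shift i j) (v, p))"
    if p: "p \<in> carrier PQ" for v p
  proof -
    have "p \<otimes>\<^bsub>PQ\<^esub> part j t \<otimes>\<^bsub>PQ\<^esub> twist j v \<otimes>\<^bsub>PQ\<^esub> part i s \<otimes>\<^bsub>PQ\<^esub> twist i (v(j := v j + 1))
        = p \<otimes>\<^bsub>PQ\<^esub> part j t \<otimes>\<^bsub>PQ\<^esub> part i s \<otimes>\<^bsub>PQ\<^esub> (twist j v \<otimes>\<^bsub>PQ\<^esub> twist i (v(j := v j + 1)))"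
      using assms p by (simp add: PQ.m_ac)
    also have "\<dots> = p \<otimes>\<^bsub>PQ\<^esub> part i (s \<otimes>\<^bsub>K i\<^esub> shift i j) \<otimes>\<^bsub>PQ\<^esub> twist i v
        \<otimes>\<^bsub>PQ\<^esub> part j t \<otimes>\<^bsub>PQ\<^esub> twist j (v(i := v i + 1))"
      unfolding twist_exchange[OF assms(1,3)]
      using assms p shift_closed by (simp add: part_mult PQ.m_ac)
    finally show ?thesis
      using assms p st by (auto simp: step_apply fun_eq_iff)
  qed
  then have "compose E (step i s) (step j t) = compose E (step j t) (step i (s \<otimes>\<^bsub>K i\<^esub> shift i j))"
    by (auto simp: compose_def E_def fun_eq_iff)
  then show ?thesis
    using assms st step_Bij by (simp add: mult_BijGroup)
qed

text \<open>Dividing by the step at the neutral element leaves a pure translation, so displacements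
  in the structure group act through \<open>trans\<close>.\<close>

lemma step_eq_trans:
  assumes "i \<in> I" "s \<in> carrier (K i)"
  shows "step i s = step i \<one>\<^bsub>K i\<^esub> \<otimes>\<^bsub>BijGroup E\<^esub> trans (part i s)"
proof -
  have "step i s x = compose E (step i \<one>\<^bsub>K i\<^esub>) (trans (part i s)) x" for x
    using assms by (cases x) (auto simp: step_def trans_def compose_def E_def part_one)
  then show ?thesis
    using assms step_Bij trans_Bij by (simp add: mult_BijGroup fun_eq_iff)
qed

text \<open>The action of \<open>emb_GP s\<close> on \<open>E\<close> is translation by the class of
  \<open>s\<close>: both are homomorphisms in \<open>s\<close> and agree on the elements
  \<open>single i a\<close>. Translation by a nontrivial class is not the identity.\<close>

lemma emb_GP_injective:
  assumes "s \<in> carrier GP" "emb_GP s = \<one>\<^bsub>SG\<^esub>"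
  shows "cls s = \<one>\<^bsub>PQ\<^esub>"
proof -
  let ?B = "BijGroup E"
  interpret B: group ?B
    by (rule group_BijGroup)
  obtain \<tau> where \<tau>: "group_hom SG ?B \<tau>"
    and \<tau>_gen: "\<And>i s. i \<in> I \<Longrightarrow> s \<in> carrier (K i) \<Longrightarrow> \<tau> (gen i s) = step i s"
    by (rule SG_universal[OF group_BijGroup, of step])
      (use step_Bij step_relation in \<open>auto simp: BijGroup_def\<close>)
  interpret \<tau>: group_hom SG ?B \<tau>
    by (rule \<tau>)
  have B: "step i s \<in> carrier ?B" "trans (part i s) \<in> carrier ?B" if "i \<in> I" "s \<in> carrier (K i)" for i s
    using step_Bij trans_Bij that by (auto simp: BijGroup_def)
  have \<tau>_disp: "\<tau> (disp i a) = trans (part i a)" if ia: "i \<in> I" "a \<in> carrier (K i)" for i a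
  proof -
    have "\<tau> (disp i a) = inv\<^bsub>?B\<^esub> step i \<one>\<^bsub>K i\<^esub> \<otimes>\<^bsub>?B\<^esub> step i a"
      using ia by (simp add: disp_def \<tau>_gen)
    also have "\<dots> = inv\<^bsub>?B\<^esub> step i \<one>\<^bsub>K i\<^esub> \<otimes>\<^bsub>?B\<^esub> (step i \<one>\<^bsub>K i\<^esub> \<otimes>\<^bsub>?B\<^esub> trans (part i a))"
      using step_eq_trans[OF ia] by simp
    also have "\<dots> = trans (part i a)"
      using B(1)[OF ia(1) K.one_closed] B(2)[OF ia] by (simp flip: B.m_assoc)
    finally show ?thesis .
  qed
  have "(\<lambda>s. \<tau> (emb_GP s)) \<in> hom GP ?B"
  proof (rule homI)
    fix x y assume "x \<in> carrier GP" "y \<in> carrier GP"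
    then show "\<tau> (emb_GP (x \<otimes>\<^bsub>GP\<^esub> y)) = \<tau> (emb_GP x) \<otimes>\<^bsub>?B\<^esub> \<tau> (emb_GP y)"
      using emb_GP.hom_closed subgroup.subset[OF subgroup_Z] by (simp add: subset_iff)
  next
    fix x assume "x \<in> carrier GP"
    then show "\<tau> (emb_GP x) \<in> carrier ?B"
      using emb_GP.hom_closed subgroup.subset[OF subgroup_Z] by (simp add: subset_iff)
  qed
  then interpret a: group_hom GP ?B "\<lambda>s. \<tau> (emb_GP s)"
    by unfold_locales
  have "(\<lambda>s. trans (cls s)) \<in> hom GP ?B"
    using hom_compose[OF cls.homh group_hom.homh[OF trans_hom]] by (simp add: o_def)
  then have b: "group_hom GP ?B (\<lambda>s. trans (cls s))"
    by unfold_locales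
  have "\<tau> (emb_GP s) = trans (cls s)"
  proof (rule a.hom_eq_on_generate[OF b])
    show "(\<Union>i\<in>I. single i ` carrier (K i)) \<subseteq> carrier GP"
      using single_closed by blast
    show "s \<in> generate GP (\<Union>i\<in>I. single i ` carrier (K i))"
      using assms(1) generate_single by simp
    fix x assume "x \<in> (\<Union>i\<in>I. single i ` carrier (K i))"
    then obtain i a where "i \<in> I" "a \<in> carrier (K i)" "x = single i a"
      by blast
    then show "\<tau> (emb_GP x) = trans (cls x)"
      using emb_GP_single \<tau>_disp by (simp add: part_def)
  qed
  then have "trans (cls s) = \<one>\<^bsub>?B\<^esub>"
    using assms(2) \<tau>.hom_one by simp
  \<comment> \<open>The class is read off from the image of the origin.\<close>
  then have "trans (cls s) (\<lambda>_. 0, \<one>\<^bsub>PQ\<^esub>) = (\<lambda>_. 0, \<one>\<^bsub>PQ\<^esub>)"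
    by (simp add: BijGroup_def E_def)
  then show ?thesis
    using assms(1) by (simp add: trans_apply)
qed

subsection \<open>The central extension\<close>

abbreviation "ZI \<equiv> product_group I (\<lambda>_. integer_group)"
abbreviation "unit_vector i \<equiv> product_single I (\<lambda>_. integer_group) i 1"

definition "image_GP = emb_GP ` carrier GP"

lemma Z_hom_SG: "group_hom (SG\<lparr>carrier := Z\<rparr>) SG (\<lambda>x. x)"
  using subgroup.subset[OF subgroup_Z] SG.group_axioms Z.group_axioms
  by (auto simp: group_hom_def group_hom_axioms_def hom_def)

lemma subgroup_image_GP: "subgroup image_GP SG"
proof -
  have "emb_GP \<in> hom GP SG"
    using hom_compose[OF emb_GP.homh group_hom.homh[OF Z_hom_SG]] by (simp add: o_def)
  then interpret h: group_hom GP SG emb_GP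
    by unfold_locales
  show ?thesis
    unfolding image_GP_def by (rule h.img_is_subgroup)
qed

lemma image_GP_subset: "image_GP \<subseteq> Z"
  using emb_GP.hom_closed by (auto simp: image_GP_def)

lemma image_GP_normal: "image_GP \<lhd> SG"
  using SG.normal_central[OF subgroup_image_GP] image_GP_subset by (auto simp: Z_def)

lemma disp_image_GP: "i \<in> I \<Longrightarrow> t \<in> carrier (K i) \<Longrightarrow> disp i t \<in> image_GP"
  unfolding image_GP_def using emb_GP_single single_closed by (metis image_eqI)

lemma image_coset_mult:
  assumes "a \<in> carrier SG" "z \<in> image_GP"
  shows "image_GP #>\<^bsub>SG\<^esub> (a \<otimes>\<^bsub>SG\<^esub> z) = image_GP #>\<^bsub>SG\<^esub> a"
proof -
  have z: "z \<in> carrier SG" "a \<otimes>\<^bsub>SG\<^esub> z = z \<otimes>\<^bsub>SG\<^esub> a"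
    using assms image_GP_subset by (auto simp: Z_def center_def)
  have "image_GP #>\<^bsub>SG\<^esub> (a \<otimes>\<^bsub>SG\<^esub> z) = (image_GP #>\<^bsub>SG\<^esub> z) #>\<^bsub>SG\<^esub> a"
    unfolding z(2) using assms z subgroup.subset[OF subgroup_image_GP]
    by (intro SG.coset_mult_assoc[symmetric])
  then show ?thesis
    using subgroup.rcos_const[OF subgroup_image_GP SG.group_axioms assms(2)] by simp
qed

lemma quotient_hom: "group_hom SG (SG Mod image_GP) (\<lambda>x. image_GP #>\<^bsub>SG\<^esub> x)"
  unfolding group_hom_def group_hom_axioms_def
  using normal.r_coset_hom_Mod[OF image_GP_normal] normal.factorgroup_is_group[OF image_GP_normal]
    SG.group_axioms by blast

lemma comm_group_quotient: "comm_group (SG Mod image_GP)"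
proof -
  interpret q: group_hom SG "SG Mod image_GP" "\<lambda>x. image_GP #>\<^bsub>SG\<^esub> x"
    by (rule quotient_hom)
  let ?S = "\<Union>i\<in>I. gen i ` carrier (K i)"
  have S: "?S \<subseteq> carrier SG"
    by auto
  show ?thesis
  proof (rule q.H.comm_group_generators)
    show "(\<lambda>x. image_GP #>\<^bsub>SG\<^esub> x) ` ?S \<subseteq> carrier (SG Mod image_GP)"
      using S q.hom_closed by blast
    show "generate (SG Mod image_GP) ((\<lambda>x. image_GP #>\<^bsub>SG\<^esub> x) ` ?S) = carrier (SG Mod image_GP)"
      using q.generate_img[OF S] generate_gen by (simp add: carrier_FactGroup)
    fix a b assume "a \<in> (\<lambda>x. image_GP #>\<^bsub>SG\<^esub> x) ` ?S" "b \<in> (\<lambda>x. image_GP #>\<^bsub>SG\<^esub> x) ` ?S"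
    then obtain i s j t where a: "i \<in> I" "s \<in> carrier (K i)" "a = image_GP #>\<^bsub>SG\<^esub> gen i s"
      and b: "j \<in> I" "t \<in> carrier (K j)" "b = image_GP #>\<^bsub>SG\<^esub> gen j t"
      by blast
    have comm: "gen i s \<otimes>\<^bsub>SG\<^esub> gen j t = (gen j t \<otimes>\<^bsub>SG\<^esub> gen i s) \<otimes>\<^bsub>SG\<^esub> comm i j"
      using gen_relation[OF a(1,2) b(1,2)] gen_shift[OF a(1,2) b(1)] a b by (simp add: SG.m_assoc)
    have "comm i j \<in> image_GP"
      using disp_image_GP[OF a(1) shift_closed[OF a(1)]] by (simp add: disp_shift)
    then have "image_GP #>\<^bsub>SG\<^esub> (gen i s \<otimes>\<^bsub>SG\<^esub> gen j t) = image_GP #>\<^bsub>SG\<^esub> (gen j t \<otimes>\<^bsub>SG\<^esub> gen i s)"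
      unfolding comm using a b by (intro image_coset_mult SG.m_closed gen_closed)
    then show "a \<otimes>\<^bsub>SG Mod image_GP\<^esub> b = b \<otimes>\<^bsub>SG Mod image_GP\<^esub> a"
      using a b q.hom_mult[of "gen i s" "gen j t"] q.hom_mult[of "gen j t" "gen i s"]
      by (simp only: gen_closed)
  qed
qed

lemma comm_group_ZI: "comm_group ZI"
  by (rule comm_group_product_group) (rule abelian_integer_group)

lemma unit_vector_closed: "unit_vector i \<in> carrier ZI"
  by (intro product_single_closed) auto

text \<open>The quotient by \<open>image_GP\<close> is abelian and the class of \<open>gen i s\<close> does not depend on \<open>s\<close>, so the
  quotient map factors through the projection to \<open>\<int>\<^sup>r\<close>. This bounds the kernel of the projection.\<close>

lemma ex_projection:
  obtains \<pi> where "group_hom SG ZI \<pi>" "\<pi> ` carrier SG = carrier ZI" "kernel SG ZI \<pi> = image_GP"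
    "image_GP = derived SG (carrier SG)"
proof -
  interpret ZI: comm_group ZI
    by (rule comm_group_ZI)
  interpret q: group_hom SG "SG Mod image_GP" "\<lambda>x. image_GP #>\<^bsub>SG\<^esub> x"
    by (rule quotient_hom)
  interpret Q: comm_group "SG Mod image_GP"
    by (rule comm_group_quotient)
  \<comment> \<open>For a value depending only on the orbit the defining relation becomes
    commutativity in \<open>ZI\<close>.\<close>
  obtain \<pi> where \<pi>: "group_hom SG ZI \<pi>"
    and \<pi>_gen: "\<And>i s. i \<in> I \<Longrightarrow> s \<in> carrier (K i) \<Longrightarrow> \<pi> (gen i s) = unit_vector i"
    by (rule SG_universal[OF ZI.group_axioms, of "\<lambda>i _. unit_vector i"])
      (use unit_vector_closed ZI.m_comm in blast)+
  interpret \<pi>: group_hom SG ZI \<pi>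
    by (rule \<pi>)
  have onto: "\<pi> ` carrier SG = carrier ZI"
  proof
    have sub: "subgroup (\<pi> ` carrier SG) ZI"
      by (rule \<pi>.img_is_subgroup)
    have "product_single I (\<lambda>_. integer_group) i n \<in> \<pi> ` carrier SG" if "i \<in> I" for i n
    proof -
      have "product_single I (\<lambda>_. integer_group) i \<in> hom integer_group ZI"
        by (rule product_single_hom) (use that in auto)
      then have "product_single I (\<lambda>_. integer_group) i (1 [^]\<^bsub>integer_group\<^esub> n) = unit_vector i [^]\<^bsub>ZI\<^esub> n"
        by (intro hom_int_pow[OF _ _ group_integer_group ZI.group_axioms]) auto
      moreover have "unit_vector i \<in> \<pi> ` carrier SG"
        using \<pi>_gen[OF that K.one_closed] gen_closed[OF that K.one_closed] by (metis image_eqI)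
      ultimately show ?thesis
        using ZI.subgroup_int_pow_closed[OF sub, of "unit_vector i" n] by simp
    qed
    then have "generate ZI (\<Union>i\<in>I. product_single I (\<lambda>_. integer_group) i ` carrier integer_group)
        \<subseteq> \<pi> ` carrier SG"
      by (intro ZI.generate_subgroup_incl[OF _ sub]) blast
    then show "carrier ZI \<subseteq> \<pi> ` carrier SG"
      using generate_product_single[of I "\<lambda>_. integer_group"] by simp
  qed (use \<pi>.hom_closed in blast)
  have ker: "kernel SG ZI \<pi> \<subseteq> image_GP"
  proof -
    \<comment> \<open>\<open>?\<psi>\<close> goes from Z^r back to the quotient and sends the
      \<open>i\<close>-th unit vector to the common class of the generators from orbit
      \<open>i\<close>. Its composite with \<open>\<pi>\<close> is the quotient map.\<close>
    let ?h = "\<lambda>i n. (image_GP #>\<^bsub>SG\<^esub> gen i \<one>\<^bsub>K i\<^esub>) [^]\<^bsub>SG Mod image_GP\<^esub> (n :: int)"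
    let ?\<psi> = "\<lambda>v. finprod (SG Mod image_GP) (\<lambda>i. ?h i (v i)) I"
    have h: "?h i \<in> hom integer_group (SG Mod image_GP)" if "i \<in> I" for i
      by (intro q.H.hom_integer_group_pow q.hom_closed gen_closed[OF that K.one_closed])
    have "?\<psi> \<in> hom ZI (SG Mod image_GP)"
      by (rule Q.finprod_in_hom) (use h in auto)
    then interpret \<psi>: group_hom ZI "SG Mod image_GP" ?\<psi>
      by unfold_locales
    have "(\<lambda>x. ?\<psi> (\<pi> x)) \<in> hom SG (SG Mod image_GP)"
      using hom_compose[OF \<pi>.homh \<psi>.homh] by (simp add: o_def)
    then have \<psi>\<pi>: "group_hom SG (SG Mod image_GP) (\<lambda>x. ?\<psi> (\<pi> x))"
      by unfold_locales
    have eq: "image_GP #>\<^bsub>SG\<^esub> x = ?\<psi> (\<pi> x)" if "x \<in> carrier SG" for x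
    proof (rule q.hom_eq_on_generate[OF \<psi>\<pi>])
      show "(\<Union>i\<in>I. gen i ` carrier (K i)) \<subseteq> carrier SG"
        by auto
      show "x \<in> generate SG (\<Union>i\<in>I. gen i ` carrier (K i))"
        using that generate_gen by simp
      fix a assume "a \<in> (\<Union>i\<in>I. gen i ` carrier (K i))"
      then obtain i s where a: "i \<in> I" "s \<in> carrier (K i)" "a = gen i s"
        by blast
      have "?\<psi> (unit_vector i) = ?h i 1"
        by (rule Q.finprod_product_single) (use a h in auto)
      also have "\<dots> = image_GP #>\<^bsub>SG\<^esub> gen i \<one>\<^bsub>K i\<^esub>"
        using q.hom_closed[OF gen_closed[OF a(1) K.one_closed]] by (rule q.H.int_pow_1)
      also have "\<dots> = image_GP #>\<^bsub>SG\<^esub> gen i s"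
        using image_coset_mult[OF gen_closed[OF a(1) K.one_closed] disp_image_GP[OF a(1,2)]]
          gen_eq[OF a(1,2)] by simp
      finally show "image_GP #>\<^bsub>SG\<^esub> a = ?\<psi> (\<pi> a)"
        using a \<pi>_gen by simp
    qed
    show ?thesis
    proof
      fix x assume "x \<in> kernel SG ZI \<pi>"
      then have x: "x \<in> carrier SG" "\<pi> x = \<one>\<^bsub>ZI\<^esub>"
        by (simp_all add: kernel_def)
      then have "image_GP #>\<^bsub>SG\<^esub> x = image_GP"
        using eq[OF x(1)] \<psi>.hom_one by (simp only: one_FactGroup)
      then show "x \<in> image_GP"
        using SG.coset_join1 x(1) subgroup_image_GP by blast
    qed
  qed
  \<comment> \<open>The inclusions close up: \<open>image_GP\<close> lies in the derived subgroup,
    that in the kernel, and the kernel in \<open>image_GP\<close>.\<close>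
  have "image_GP \<subseteq> derived SG (carrier SG)"
    using image_GP_subset by (auto simp: Z_def)
  moreover have "derived SG (carrier SG) \<subseteq> kernel SG ZI \<pi>"
    by (rule \<pi>.derived_subset_kernel[OF comm_group_ZI])
  ultimately show thesis
    using that[OF \<pi> onto] ker by blast
qed

lemma central_extension:
  "is_central_extension SG ZI PQ \<and> PQ \<cong> SG\<lparr>carrier := derived SG (carrier SG)\<rparr>"
proof -
  obtain emb where emb: "emb \<in> hom PQ (SG\<lparr>carrier := Z\<rparr>)"
    and emb_cls: "\<And>s. s \<in> carrier GP \<Longrightarrow> emb (cls s) = emb_GP s"
    using ex_emb by blast
  interpret emb: group_hom PQ "SG\<lparr>carrier := Z\<rparr>" emb
    using emb by unfold_locales
  obtain \<pi> where \<pi>: "group_hom SG ZI \<pi>" "\<pi> ` carrier SG = carrier ZI" "kernel SG ZI \<pi> = image_GP"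
    "image_GP = derived SG (carrier SG)"
    by (rule ex_projection)
  have inj: "inj_on emb (carrier PQ)"
    unfolding emb.inj_on_one_iff using emb_GP_injective emb_cls by (auto simp: carrier_PQ)
  have img: "emb ` carrier PQ = image_GP"
    unfolding carrier_PQ image_GP_def by (simp add: image_image emb_cls)
  have hom: "emb \<in> hom PQ SG"
    using hom_compose[OF emb group_hom.homh[OF Z_hom_SG]] by (simp add: o_def)
  then have "short_exact PQ SG ZI emb \<pi>"
    using \<pi> inj img PQ.group_axioms SG.group_axioms
    by (simp add: short_exact_def group_hom_def group_hom_axioms_def)
  moreover have "z \<otimes>\<^bsub>SG\<^esub> g = g \<otimes>\<^bsub>SG\<^esub> z" if "z \<in> emb ` carrier PQ" "g \<in> carrier SG" for z g
    using that image_GP_subset unfolding img Z_def center_def by blast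
  ultimately have "is_central_extension SG ZI PQ"
    unfolding is_central_extension_def by blast
  moreover have "emb \<in> iso PQ (SG\<lparr>carrier := derived SG (carrier SG)\<rparr>)"
    using hom inj img \<pi>(4) by (auto simp: iso_def hom_def bij_betw_def)
  ultimately show ?thesis
    by (auto simp: is_iso_def)
qed

text \<open>The factors \<open>K i\<close> are the orbits of the finite quandle in coordinates, so
  their finiteness is read off from \<open>Q\<close> and not from the relators.\<close>

lemma finite_param_quotient:
  assumes "finite Q"
  shows "finite (carrier PQ)"
proof -
  have fin: "finite (SIGMA i:I. carrier (K i))"
    using bij_f assms bij_betw_finite by blast
  have "finite (carrier (K i))" if "i \<in> I" for i
  proof (rule finite_subset)
    show "carrier (K i) \<subseteq> snd ` (SIGMA i:I. carrier (K i))"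
      using that by force
  qed (rule finite_imageI[OF fin])
  then have "finite (carrier GP)"
    unfolding GM_product_def carrier_product_group by (intro finite_PiE) auto
  then show ?thesis
    by (simp add: carrier_PQ)
qed

end

theorem theorem3p2:
  fixes Q :: "'a set" and tri :: "'a \<Rightarrow> 'a \<Rightarrow> 'a" and r :: nat and orb :: "nat \<Rightarrow> 'a set"
  assumes "abelian_quandle Q tri"
    and "finite Q"
    and "bij_betw orb {1..r} (quandle_orbits Q tri)"
  shows "is_central_extension (structure_group Q tri)
           (product_group {1..r} (\<lambda>_. integer_group)) (parameter_group Q tri r orb)
       \<and> finite (carrier (parameter_group Q tri r orb))
       \<and> comm_group (parameter_group Q tri r orb)
       \<and> parameter_group Q tri r orb \<cong>
           (structure_group Q tri)
             \<lparr>carrier := derived (structure_group Q tri) (carrier (structure_group Q tri))\<rparr>"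
proof -
  interpret abelian_quandle_ordered_orbits Q tri r orb
    using assms by (simp add: abelian_quandle_ordered_orbits_def abelian_quandle_ordered_orbits_axioms_def)
  define M where "M = quandle_parameters Q tri r orb"
  \<comment> \<open>The parameters are selected by \<open>SOME\<close>, so their existence yields
    the defining property of the selected \<open>M\<close>.\<close>
  have "is_parameters Q tri r orb M"
    unfolding M_def quandle_parameters_def using ex_parameters by (rule someI_ex)
  then obtain f where f: "f \<in> quandle_iso Q tri (Q_carrier r M) (Q_op r M)"
    unfolding is_parameters_def by blast
  interpret P: parametrized_quandle Q tri r M f
    using closed f by unfold_locales
  show ?thesis
    unfolding parameter_group_def M_def[symmetric]
    using P.central_extension P.finite_param_quotient[OF assms(2)] P.PQ.comm_group_axioms
    by (simp add: P.SG_def)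
qed

end
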